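(* Let $p$ be an odd prime and $r \ge 1$ an integer. Then \[\Delta^{\ast}(\mathcal{B}_{\pm}(C_p^r)) = \{ \gcd(d_1, \dots, d_r) \colon d_1, \dots, d_r \in \Delta^{\ast}(\mathcal{B}_{\pm}(C_p))\},\] where $C_p$ denotes the cyclic group of order $p$ and $C_p^r$ its $r$-fold direct sum.
   Context: For a subset $G_0$ of an abelian group $G$ (written additively), a sequence over $G_0$ is a finite unordered list $S = g_1 \cdots g_\ell$ of elements of $G_0$ (repetitions allowed), i.e. an element of the free commutative monoid over $G_0$ with concatenation as operation; $|S|=\ell$. $S$ is a plus-minus weighted zero-sum sequence if $\sum_{i} \epsilon_i g_i = 0$ for some $\epsilon_i \in \{+1,-1\}$. $\mathcal{B}_{\pm}(G_0)$ is the monoid of all such sequences. For a monoid $H$ with trivial unit group: atoms are non-identity elements not a product of two non-identity elements; $\mathsf{L}_H(a)$ is the set of all $k$ such that $a$ is a product of $k$ atoms; for finite $L=\{a_0<\dots<a_k\}\subseteq\mathbb{Z}$, $\Delta(L)=\{a_i-a_{i-1}\colon i\in[1,k]\}$; $\Delta(H)=\bigcup_{a\in H}\Delta(\mathsf{L}_H(a))$. A submonoid $S\subseteq H$ is divisor-closed if $s\in S$, $a \in H$ and $a$ divides $s$ in $H$ imply $a\in S$. $\Delta^{\ast}(H)=\{\min\Delta(S)\colon S\subseteq H \text{ divisor-closed submonoid},\ \Delta(S)\neq\emptyset\}$. *)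

theory Defs
  imports
    "HOL-Algebra.Algebra"
    "HOL-Library.Multiset"
    "HOL-Computational_Algebra.Primes"
begin

text \<open>
  Abelian groups are HOL-Algebra groups, hence written multiplicatively: the weighted sum
  \<open>\<epsilon>\<^sub>1 g\<^sub>1 + \<dots> + \<epsilon>\<^sub>l g\<^sub>l\<close> appears as a product of the integer powers of the \<open>g\<^sub>i\<close>.
\<close>

definition pm_zero_sum :: "('a, 'b) monoid_scheme \<Rightarrow> 'a multiset \<Rightarrow> bool" where
  "pm_zero_sum G S \<longleftrightarrow>
     (\<exists>(gs :: 'a list) (\<epsilon> :: nat \<Rightarrow> int).
        mset gs = S \<and>
        (\<forall>i<length gs. \<epsilon> i \<in> {1, -1}) \<and>
        (\<Otimes>\<^bsub>G\<^esub>i\<in>{..<length gs}. (gs ! i) [^]\<^bsub>G\<^esub> \<epsilon> i) = \<one>\<^bsub>G\<^esub>)"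

text \<open>Intended for \<open>G\<^sub>0 \<subseteq> carrier G\<close>.\<close>

definition pm_monoid :: "('a, 'b) monoid_scheme \<Rightarrow> 'a set \<Rightarrow> 'a multiset monoid" where
  "pm_monoid G G\<^sub>0 =
     \<lparr>carrier = {S. set_mset S \<subseteq> G\<^sub>0 \<and> pm_zero_sum G S}, monoid.mult = (+), one = {#}\<rparr>"

text \<open>The definitions below are for commutative monoids with trivial unit group.\<close>

definition monoid_atoms :: "('a, 'b) monoid_scheme \<Rightarrow> 'a set" where
  "monoid_atoms H =
     {a \<in> carrier H. a \<noteq> \<one>\<^bsub>H\<^esub> \<and>
        \<not> (\<exists>b\<in>carrier H. \<exists>c\<in>carrier H. b \<noteq> \<one>\<^bsub>H\<^esub> \<and> c \<noteq> \<one>\<^bsub>H\<^esub> \<and> a = b \<otimes>\<^bsub>H\<^esub> c)}"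

definition length_set :: "('a, 'b) monoid_scheme \<Rightarrow> 'a \<Rightarrow> nat set" where
  "length_set H a =
     {k. \<exists>as. set as \<subseteq> monoid_atoms H \<and> length as = k \<and> foldr (\<otimes>\<^bsub>H\<^esub>) as \<one>\<^bsub>H\<^esub> = a}"

text \<open>The differences of consecutive elements; this also makes sense when the set is infinite.\<close>

definition delta_of_set :: "nat set \<Rightarrow> nat set" where
  "delta_of_set L = {b - a |a b. a \<in> L \<and> b \<in> L \<and> a < b \<and> L \<inter> {a<..<b} = {}}"

definition delta_set :: "('a, 'b) monoid_scheme \<Rightarrow> nat set" where
  "delta_set H = (\<Union>a\<in>carrier H. delta_of_set (length_set H a))"

definition divisor_closed_submonoid :: "'a set \<Rightarrow> ('a, 'b) monoid_scheme \<Rightarrow> bool" where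
  "divisor_closed_submonoid S H \<longleftrightarrow>
     submonoid S H \<and> (\<forall>s\<in>S. \<forall>a\<in>carrier H. a divides\<^bsub>H\<^esub> s \<longrightarrow> a \<in> S)"

text \<open>The minimum is a \<open>LEAST\<close>, since a set of distances may be infinite.\<close>

definition delta_star :: "('a, 'b) monoid_scheme \<Rightarrow> nat set" where
  "delta_star H =
     {(LEAST d. d \<in> delta_set (H\<lparr>carrier := S\<rparr>)) |S.
        divisor_closed_submonoid S H \<and> delta_set (H\<lparr>carrier := S\<rparr>) \<noteq> {}}"

definition elementary_group :: "nat \<Rightarrow> nat \<Rightarrow> (nat \<Rightarrow> int) monoid" where
  "elementary_group p r = sum_group {1..r} (\<lambda>_. integer_mod_group p)"

end

theory Submission
  imports Defs
begin

text \<open>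
  Divisor-closed submonoids of \<open>\<B>\<^sub>\<plusminus>(G)\<close> are the monoids \<open>\<B>\<^sub>\<plusminus>(A)\<close> with \<open>A \<subseteq> G\<close>. If \<open>U\<close> is an atom
  without \<open>0\<close>, then \<open>U\<^sup>2\<close> is both a product of two atoms and the product of the \<open>|U|\<close> atoms \<open>g\<^sup>2\<close>;
  hence the minimal distance of \<open>\<B>\<^sub>\<plusminus>(A)\<close> is \<open>D(A) = gcd {|U| - 2}\<close>, which divides \<open>p - 2\<close> because of
  the atoms \<open>g\<^sup>p\<close>.

  Let \<open>E\<close> be a maximal independent subset of \<open>A\<close>. If every element of \<open>A\<close> is a multiple of some
  \<open>e \<in> E\<close>, then every atom lives on a single line \<open>\<langle>e\<rangle> \<cong> C\<^sub>p\<close> and \<open>D(A)\<close> is the gcd of at most \<open>r\<close>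
  minimal distances over \<open>C\<^sub>p\<close>. Otherwise \<open>A\<close> contains some \<open>g = \<Sum> a\<^sub>e e\<close> with at least two nonzero
  coefficients, and comparing the lengths of atoms \<open>g \<Prod> e\<^bsup>n(e)\<^esup>\<close> and \<open>g\<^sup>2 \<Prod> e\<^bsup>n(e)\<^esup>\<close> gives \<open>D(A) | p\<close>,
  so \<open>D(A) = 1\<close>.
\<close>


section \<open>Weights of plus-minus zero-sum sequences\<close>

text \<open>\<open>signed_count c t\<close>: \<open>t\<close> is a sum of \<open>c\<close> signs.\<close>

definition signed_count :: "nat \<Rightarrow> int \<Rightarrow> bool" where
  "signed_count c t \<longleftrightarrow> \<bar>t\<bar> \<le> int c \<and> even (int c - t)"

lemma signed_count_Suc:
  "signed_count (Suc c) t \<longleftrightarrow> (\<exists>e\<in>{1, -1}. signed_count c (t - e))"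
proof
  assume "signed_count (Suc c) t"
  \<comment> \<open>Remove the sign that moves \<open>t\<close> towards 0. For \<open>t = 0\<close>
    the parity makes \<open>c\<close> odd, so \<open>c \<ge> 1\<close> and the step away from 0
    stays within the bound.\<close>
  then have "signed_count c (t - (if t > 0 then 1 else - 1))"
    unfolding signed_count_def by (auto split: if_splits) presburger+
  then show "\<exists>e\<in>{1, -1}. signed_count c (t - e)" by (auto split: if_splits)
next
  assume "\<exists>e\<in>{1, -1}. signed_count c (t - e)"
  then show "signed_count (Suc c) t" unfolding signed_count_def by auto
qed

lemma signed_count_0 [simp]: "signed_count 0 t \<longleftrightarrow> t = 0"
  by (auto simp: signed_count_def)

lemma signed_count_even: "even c \<Longrightarrow> signed_count c 0"
  by (simp add: signed_count_def)

lemma signed_count_self: "signed_count c (int c)"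
  by (simp add: signed_count_def)

lemma signed_count_add:
  "signed_count c s \<Longrightarrow> signed_count d t \<Longrightarrow> signed_count (c + d) (s + t)"
  unfolding signed_count_def by auto

context comm_group
begin

lemma finprod_int_pow_add:
  fixes s t :: "'i \<Rightarrow> int"
  assumes "f \<in> A \<rightarrow> carrier G"
  shows "finprod G (\<lambda>x. f x [^] (s x + t x)) A =
    finprod G (\<lambda>x. f x [^] s x) A \<otimes> finprod G (\<lambda>x. f x [^] t x) A"
proof -
  have "finprod G (\<lambda>x. f x [^] (s x + t x)) A = finprod G (\<lambda>x. f x [^] s x \<otimes> f x [^] t x) A"
    using assms by (intro finprod_cong') (auto simp: int_pow_mult Pi_iff)
  also have "\<dots> = finprod G (\<lambda>x. f x [^] s x) A \<otimes> finprod G (\<lambda>x. f x [^] t x) A"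
    using assms by (intro finprod_multf) auto
  finally show ?thesis .
qed

lemma finprod_int_pow_single:
  assumes "finite A" "a \<in> A" "f \<in> A \<rightarrow> carrier G"
  shows "finprod G (\<lambda>x. f x [^] (if x = a then k else (0::int))) A = f a [^] k"
proof -
  have "finprod G (\<lambda>x. f x [^] (if x = a then k else (0::int))) A =
    finprod G (\<lambda>x. if x = a then f x [^] k else \<one>) A"
    using assms by (intro finprod_cong') (auto simp: Pi_iff)
  moreover have "(\<lambda>x. f x [^] k) \<in> A \<rightarrow> carrier G"
    using assms(3) by (simp add: Pi_iff)
  ultimately show ?thesis
    using finprod_singleton_swap[OF assms(2,1), of "\<lambda>x. f x [^] k"] by simp
qed

lemma finprod_int_pow_pow:
  fixes t :: "'i \<Rightarrow> int" and k :: int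
  assumes "finite A" "f \<in> A \<rightarrow> carrier G"
  shows "finprod G (\<lambda>x. f x [^] t x) A [^] k = finprod G (\<lambda>x. f x [^] (t x * k)) A"
  using assms
proof (induction A rule: finite_induct)
  case (insert a A)
  then have "finprod G (\<lambda>x. f x [^] t x) A \<in> carrier G" by (intro finprod_closed) auto
  with insert show ?case
    by (subst (1 2) finprod_insert) (auto simp: int_pow_distrib int_pow_pow)
qed simp

text \<open>Only the sum of the signs given to the copies of \<open>g\<close> matters, and the
  possible sums are those described by \<open>signed_count\<close>. Both sides obey the same
  recursion when the last term of the list is removed: its sign is split off from the product on one
  side and from the weight of that term on the other.\<close>

lemma signs_iff_weights:
  assumes "finite A" "A \<subseteq> carrier G" "set gs \<subseteq> A"
  shows "(\<exists>\<epsilon> :: nat \<Rightarrow> int. (\<forall>i<length gs. \<epsilon> i \<in> {1, -1}) \<and>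
      (\<Otimes>i\<in>{..<length gs}. (gs ! i) [^] \<epsilon> i) = x) \<longleftrightarrow>
    (\<exists>t. (\<forall>g\<in>A. signed_count (count (mset gs) g) (t g)) \<and> (\<Otimes>g\<in>A. g [^] t g) = x)"
  (is "?L gs x \<longleftrightarrow> ?R gs x")
  using assms(3)
proof (induction gs arbitrary: x rule: rev_induct)
  case Nil
  have "(\<Otimes>g\<in>A. g [^] t g) = \<one>" if "\<forall>g\<in>A. t g = 0" for t :: "'a \<Rightarrow> int"
    using that by (intro finprod_one_eqI) auto
  then show ?case by auto
next
  case (snoc g gs)
  let ?n = "length gs"
  have gA: "g \<in> A" and gs: "set gs \<subseteq> A" and g: "g \<in> carrier G"
    using snoc.prems assms(2) by auto
  have id: "(\<lambda>g. g) \<in> A \<rightarrow> carrier G" using assms(2) by auto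
  have split: "(\<Otimes>i\<in>{..<length (gs @ [g])}. ((gs @ [g]) ! i) [^] \<epsilon> i) =
      g [^] \<epsilon> ?n \<otimes> (\<Otimes>i\<in>{..<?n}. (gs ! i) [^] \<epsilon> i)" for \<epsilon> :: "nat \<Rightarrow> int"
  proof -
    have c: "(\<lambda>i. (gs ! i) [^] \<epsilon> i) \<in> {..<?n} \<rightarrow> carrier G"
      using gs assms(2) by (auto intro!: int_pow_closed simp: subset_iff)
    have "(\<Otimes>i\<in>{..<?n}. ((gs @ [g]) ! i) [^] \<epsilon> i) = (\<Otimes>i\<in>{..<?n}. (gs ! i) [^] \<epsilon> i)"
      by (intro finprod_cong' c) (auto simp: nth_append)
    moreover have "(\<lambda>i. ((gs @ [g]) ! i) [^] \<epsilon> i) \<in> {..<?n} \<rightarrow> carrier G"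
      using c by (auto simp: nth_append Pi_iff)
    ultimately show ?thesis using g by (simp add: lessThan_Suc)
  qed
  have L: "?L (gs @ [g]) x \<longleftrightarrow> (\<exists>e\<in>{1,-1}. \<exists>y. ?L gs y \<and> x = g [^] (e::int) \<otimes> y)"
  proof
    assume "?L (gs @ [g]) x"
    then obtain \<epsilon> :: "nat \<Rightarrow> int" where e: "\<forall>i<Suc ?n. \<epsilon> i \<in> {1, -1}"
      and x: "(\<Otimes>i\<in>{..<length (gs @ [g])}. ((gs @ [g]) ! i) [^] \<epsilon> i) = x" by auto
    show "\<exists>e\<in>{1,-1}. \<exists>y. ?L gs y \<and> x = g [^] (e::int) \<otimes> y"
    proof (intro bexI exI conjI)
      show "\<forall>i<?n. \<epsilon> i \<in> {1, -1}" and "\<epsilon> ?n \<in> {1, -1}" using e by simp_all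
      show "x = g [^] \<epsilon> ?n \<otimes> (\<Otimes>i\<in>{..<?n}. (gs ! i) [^] \<epsilon> i)" using x[unfolded split] by simp
    qed simp
  next
    assume "\<exists>e\<in>{1,-1}. \<exists>y. ?L gs y \<and> x = g [^] (e::int) \<otimes> y"
    then obtain e :: int and \<epsilon> :: "nat \<Rightarrow> int" where e: "e \<in> {1, -1}" "\<forall>i<?n. \<epsilon> i \<in> {1, -1}"
      and x: "x = g [^] e \<otimes> (\<Otimes>i\<in>{..<?n}. (gs ! i) [^] \<epsilon> i)" by blast
    let ?\<epsilon> = "\<epsilon>(?n := e)"
    have "(\<Otimes>i\<in>{..<?n}. (gs ! i) [^] ?\<epsilon> i) = (\<Otimes>i\<in>{..<?n}. (gs ! i) [^] \<epsilon> i)"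
      using gs assms(2) by (intro finprod_cong') (auto simp: subset_iff)
    then show "?L (gs @ [g]) x"
      unfolding split using e x by (intro exI[of _ ?\<epsilon>]) (auto simp: less_Suc_eq)
  qed
  have R: "?R (gs @ [g]) x \<longleftrightarrow> (\<exists>e\<in>{1,-1}. \<exists>y. ?R gs y \<and> x = g [^] (e::int) \<otimes> y)"
  proof
    assume "?R (gs @ [g]) x"
    then obtain t where t: "\<forall>h\<in>A. signed_count (count (mset (gs @ [g])) h) (t h)"
      and x: "(\<Otimes>h\<in>A. h [^] t h) = x" by blast
    from t gA have "signed_count (Suc (count (mset gs) g)) (t g)" by (auto split: if_splits)
    then obtain e where e: "e \<in> {1, -1}" "signed_count (count (mset gs) g) (t g - e)"
      unfolding signed_count_Suc by blast
    let ?t = "\<lambda>h. t h - (if h = g then e else 0)"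
    have "x = (\<Otimes>h\<in>A. h [^] ((if h = g then e else 0) + ?t h))"
      unfolding x[symmetric] using id by (intro finprod_cong') auto
    also have "\<dots> = g [^] e \<otimes> (\<Otimes>h\<in>A. h [^] ?t h)"
      unfolding finprod_int_pow_add[OF id] finprod_int_pow_single[OF assms(1) gA id] ..
    finally have x': "x = g [^] e \<otimes> (\<Otimes>h\<in>A. h [^] ?t h)" .
    show "\<exists>e\<in>{1,-1}. \<exists>y. ?R gs y \<and> x = g [^] (e::int) \<otimes> y"
    proof (intro bexI exI conjI)
      show "\<forall>h\<in>A. signed_count (count (mset gs) h) (?t h)" using t e by auto
      show "x = g [^] e \<otimes> (\<Otimes>h\<in>A. h [^] ?t h)" by (fact x')
    qed (use e in auto)
  next
    assume "\<exists>e\<in>{1,-1}. \<exists>y. ?R gs y \<and> x = g [^] (e::int) \<otimes> y"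
    then obtain e :: int and t where e: "e \<in> {1, -1}"
      and t: "\<forall>h\<in>A. signed_count (count (mset gs) h) (t h)"
      and x: "x = g [^] e \<otimes> (\<Otimes>h\<in>A. h [^] t h)" by blast
    let ?t = "\<lambda>h. (if h = g then e else 0) + t h"
    have "(\<Otimes>h\<in>A. h [^] ?t h) = x"
      unfolding finprod_int_pow_add[OF id] finprod_int_pow_single[OF assms(1) gA id] x ..
    moreover have "\<forall>h\<in>A. signed_count (count (mset (gs @ [g])) h) (?t h)"
      using t e by (auto simp: signed_count_Suc)
    ultimately show "?R (gs @ [g]) x" by (intro exI[of _ ?t] conjI)
  qed
  show ?case unfolding L R snoc.IH[OF gs] ..
qed

text \<open>The ordering disappears, and only multiplicities remain. \<open>A\<close> may exceed the
  support, since elements that do not occur get weight 0; so sequences with different supports can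
  be compared over one \<open>A\<close>.\<close>

lemma pm_zero_sum_iff_weights:
  assumes "finite A" "A \<subseteq> carrier G" "set_mset S \<subseteq> A"
  shows "pm_zero_sum G S \<longleftrightarrow>
    (\<exists>t. (\<forall>g\<in>A. signed_count (count S g) (t g)) \<and> (\<Otimes>g\<in>A. g [^] t g) = \<one>)"
    (is "_ \<longleftrightarrow> ?R")
proof
  assume "pm_zero_sum G S"
  then obtain gs where gs: "mset gs = S" and
    "\<exists>\<epsilon> :: nat \<Rightarrow> int. (\<forall>i<length gs. \<epsilon> i \<in> {1, -1}) \<and>
      (\<Otimes>i\<in>{..<length gs}. (gs ! i) [^] \<epsilon> i) = \<one>"
    unfolding pm_zero_sum_def by auto
  moreover have "set gs \<subseteq> A" using gs assms(3) by auto
  ultimately show ?R using signs_iff_weights[OF assms(1,2)] by blast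
next
  assume ?R
  moreover obtain gs where gs: "mset gs = S" using ex_mset by blast
  moreover have "set gs \<subseteq> A" using gs assms(3) by auto
  ultimately have "\<exists>\<epsilon> :: nat \<Rightarrow> int. (\<forall>i<length gs. \<epsilon> i \<in> {1, -1}) \<and>
      (\<Otimes>i\<in>{..<length gs}. (gs ! i) [^] \<epsilon> i) = \<one>"
    using signs_iff_weights[OF assms(1,2)] by blast
  with gs show "pm_zero_sum G S" unfolding pm_zero_sum_def by blast
qed

end

section \<open>Atoms and lengths of factorizations\<close>

definition pm_atom :: "('a, 'b) monoid_scheme \<Rightarrow> 'a multiset \<Rightarrow> bool" where
  "pm_atom G U \<longleftrightarrow> U \<noteq> {#} \<and> pm_zero_sum G U \<and>
     (\<forall>B C. pm_zero_sum G B \<longrightarrow> pm_zero_sum G C \<longrightarrow> U = B + C \<longrightarrow> B = {#} \<or> C = {#})"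

text \<open>Both factors of a sequence over \<open>A\<close> are again over \<open>A\<close>, so
  whether it is an atom does not depend on the ambient set.\<close>

lemma monoid_atoms_pm_monoid:
  "monoid_atoms (pm_monoid G A) = {U. set_mset U \<subseteq> A \<and> pm_atom G U}"
proof (intro equalityI subsetI)
  fix U assume U: "U \<in> monoid_atoms (pm_monoid G A)"
  have "B = {#} \<or> C = {#}" if "pm_zero_sum G B" "pm_zero_sum G C" "U = B + C" for B C
    using U that unfolding monoid_atoms_def pm_monoid_def by auto
  with U show "U \<in> {U. set_mset U \<subseteq> A \<and> pm_atom G U}"
    unfolding pm_atom_def by (auto simp: monoid_atoms_def pm_monoid_def)
qed (auto simp: monoid_atoms_def pm_monoid_def pm_atom_def)

lemma length_set_pm_monoid:
  "length_set (pm_monoid G A) S =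
     {k. \<exists>us. (\<forall>U\<in>set us. set_mset U \<subseteq> A \<and> pm_atom G U) \<and> length us = k \<and> sum_list us = S}"
  unfolding length_set_def monoid_atoms_pm_monoid
  by (auto simp: pm_monoid_def sum_list.eq_foldr)

context comm_group
begin

lemma pm_zero_sum_empty [simp]: "pm_zero_sum G {#}"
  using pm_zero_sum_iff_weights[of "{}" "{#}"] by simp

lemma pm_zero_sum_add:
  assumes "pm_zero_sum G S" "pm_zero_sum G T"
    and "set_mset S \<subseteq> carrier G" "set_mset T \<subseteq> carrier G"
  shows "pm_zero_sum G (S + T)"
proof -
  let ?A = "set_mset S \<union> set_mset T"
  have A: "finite ?A" "?A \<subseteq> carrier G" and id: "(\<lambda>g. g) \<in> ?A \<rightarrow> carrier G"
    using assms by auto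
  obtain s where s: "\<forall>g\<in>?A. signed_count (count S g) (s g)" "(\<Otimes>g\<in>?A. g [^] s g) = \<one>"
    using pm_zero_sum_iff_weights[OF A, of S] assms by auto
  obtain t where t: "\<forall>g\<in>?A. signed_count (count T g) (t g)" "(\<Otimes>g\<in>?A. g [^] t g) = \<one>"
    using pm_zero_sum_iff_weights[OF A, of T] assms by auto
  have "(\<Otimes>g\<in>?A. g [^] (s g + t g)) = \<one>"
    unfolding finprod_int_pow_add[OF id] s t by simp
  then show ?thesis
    using pm_zero_sum_iff_weights[OF A, of "S + T"] s t
    by (auto intro!: exI[of _ "\<lambda>g. s g + t g"] signed_count_add)
qed

text \<open>The two copies of each term take opposite signs, so all weights can be 0.\<close>

lemma pm_zero_sum_double:
  assumes "set_mset S \<subseteq> carrier G" shows "pm_zero_sum G (S + S)"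
  using assms pm_zero_sum_iff_weights[of "set_mset S" "S + S"]
  by (auto intro!: exI[of _ "\<lambda>_. 0"] signed_count_even)

lemma pm_zero_sum_replicate_iff:
  assumes "g \<in> carrier G"
  shows "pm_zero_sum G (replicate_mset n g) \<longleftrightarrow> (\<exists>t. signed_count n t \<and> g [^] t = \<one>)"
proof -
  have "pm_zero_sum G (replicate_mset n g) \<longleftrightarrow>
      (\<exists>t :: 'a \<Rightarrow> int. signed_count n (t g) \<and> g [^] t g = \<one>)"
    using assms by (subst pm_zero_sum_iff_weights[of "{g}"]) (auto simp: in_replicate_mset)
  also have "\<dots> \<longleftrightarrow> (\<exists>t. signed_count n t \<and> g [^] t = \<one>)"
    by (auto intro: exI[of _ "\<lambda>_. _"])
  finally show ?thesis .
qed

lemma pm_zero_sum_single_iff: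
  assumes "g \<in> carrier G" shows "pm_zero_sum G {#g#} \<longleftrightarrow> g = \<one>"
  using pm_zero_sum_replicate_iff[OF assms, of 1] assms
  by (auto simp: signed_count_Suc[of 0, simplified] int_pow_neg)

lemma carrier_pm_monoid: "carrier (pm_monoid G A) = {S. set_mset S \<subseteq> A \<and> pm_zero_sum G S}"
  by (simp add: pm_monoid_def)

text \<open>A proper splitting of at most three terms has a factor of length 1, and a single
  nontrivial element is not zero-sum.\<close>

lemma pm_atom_size_le_3:
  assumes "pm_zero_sum G U" "U \<noteq> {#}" "set_mset U \<subseteq> carrier G - {\<one>}" "size U \<le> 3"
  shows "pm_atom G U"
  unfolding pm_atom_def
proof (intro conjI allI impI)
  fix B C assume BC: "pm_zero_sum G B" "pm_zero_sum G C" "U = B + C"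
  have no1: "size V \<noteq> 1" if "pm_zero_sum G V" "set_mset V \<subseteq> set_mset U" for V
  proof
    assume "size V = 1"
    then obtain x where "V = {#x#}" using size_1_singleton_mset by blast
    with that assms(3) pm_zero_sum_single_iff[of x] show False by auto
  qed
  have "size B \<noteq> 1" "size C \<noteq> 1" "size B + size C \<le> 3"
    using no1[OF BC(1)] no1[OF BC(2)] BC(3) assms(4) by auto
  then have "size B = 0 \<or> size C = 0" by presburger
  then show "B = {#} \<or> C = {#}" by simp
qed (use assms in auto)

lemma pm_atom_square:
  assumes "g \<in> carrier G" "g \<noteq> \<one>" shows "pm_atom G {#g, g#}"
  using pm_zero_sum_double[of "{#g#}"] assms by (intro pm_atom_size_le_3) auto

lemma pm_atom_one_mem_iff:
  assumes "pm_atom G U" "set_mset U \<subseteq> carrier G" "\<one> \<in># U" shows "U = {#\<one>#}"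
proof -
  obtain V where V: "U = add_mset \<one> V" using assms(3) by (metis multi_member_split)
  let ?A = "insert \<one> (set_mset V)"
  have A: "finite ?A" "?A \<subseteq> carrier G" using assms V by auto
  have "pm_zero_sum G (add_mset \<one> V)" using assms V by (simp add: pm_atom_def)
  moreover have "set_mset U \<subseteq> ?A" using V by simp
  ultimately obtain t
    where t: "\<forall>g\<in>?A. signed_count (count U g) (t g)" "(\<Otimes>g\<in>?A. g [^] t g) = \<one>"
    using pm_zero_sum_iff_weights[OF A, of U] V by blast
  from t(1) have "signed_count (Suc (count V \<one>)) (t \<one>)" using V by auto
  then obtain e where e: "signed_count (count V \<one>) (t \<one> - e)"
    unfolding signed_count_Suc by blast
  \<comment> \<open>Powers of \<open>\<one>\<close> are trivial, so taking one sign off its weight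
    keeps the product. The new weights fit \<open>V\<close>, which makes \<open>{#\<one>#}\<close> a
    factor with zero-sum cofactor.\<close>
  let ?t = "t(\<one> := t \<one> - e)"
  have "(\<Otimes>g\<in>?A. g [^] ?t g) = (\<Otimes>g\<in>?A. g [^] t g)"
    using A by (intro finprod_cong') auto
  then have "(\<Otimes>g\<in>?A. g [^] ?t g) = \<one>" using t(2) by simp
  moreover have "\<forall>g\<in>?A. signed_count (count V g) (?t g)" using t(1) e V by auto
  ultimately have "pm_zero_sum G V"
    using pm_zero_sum_iff_weights[OF A, of V] by blast
  then have "V = {#}"
    using assms(1) pm_zero_sum_single_iff[of \<one>] V unfolding pm_atom_def
    by (metis add_mset_add_single add_mset_not_empty one_closed)
  with V show ?thesis by simp
qed

end


section \<open>Minimal distances\<close>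

text \<open>The summand \<open>count U \<one>\<close> makes the atom \<open>{#\<one>#}\<close> contribute \<open>0\<close>; for all other atoms it vanishes, and
  the subtraction never truncates.\<close>

definition pm_gcd :: "('a, 'b) monoid_scheme \<Rightarrow> 'a set \<Rightarrow> nat" where
  "pm_gcd G A = Gcd ((\<lambda>U. size U + count U \<one>\<^bsub>G\<^esub> - 2) ` {U. set_mset U \<subseteq> A \<and> pm_atom G U})"

text \<open>The distance leads from \<open>l\<close> to its successor in \<open>L\<close>.\<close>

lemma delta_of_set_between:
  fixes L :: "nat set"
  assumes "k \<in> L" "l \<in> L" "l < k"
  shows "\<exists>d\<in>delta_of_set L. d \<le> k - l"
proof -
  define s where "s = (LEAST x. x \<in> L \<and> l < x)"
  have s: "s \<in> L \<and> l < s" unfolding s_def by (rule LeastI[of _ k]) (use assms in auto)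
  have "s \<le> k" unfolding s_def by (rule Least_le) (use assms in auto)
  have "x \<notin> L" if "l < x" "x < s" for x
    using not_less_Least[of x "\<lambda>x. x \<in> L \<and> l < x"] that by (auto simp: s_def)
  then have "L \<inter> {l<..<s} = {}" by auto
  with s assms have "s - l \<in> delta_of_set L" unfolding delta_of_set_def by blast
  with \<open>s \<le> k\<close> show ?thesis by (intro bexI[of _ "s - l"]) auto
qed

text \<open>The differences of two lengths of a common element form a subgroup \<open>R\<close> of
  the integers; \<open>add\<close> gives closure under addition. The least distance \<open>m\<close>
  lies in \<open>R\<close>, and a positive element of \<open>R\<close> below \<open>m\<close> would
  enclose a distance smaller than \<open>m\<close>. Hence \<open>m\<close> generates
  \<open>R\<close>, by division with remainder.\<close>

lemma Least_delta_dvd: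
  fixes L :: "'m::comm_monoid_add \<Rightarrow> nat set"
  assumes add: "\<And>a b k l. k \<in> L a \<Longrightarrow> l \<in> L b \<Longrightarrow> k + l \<in> L (a + b)"
    and ne: "(\<Union>a. delta_of_set (L a)) \<noteq> {}" and kl: "k \<in> L a" "l \<in> L a"
  shows "int (LEAST d. d \<in> (\<Union>a. delta_of_set (L a))) dvd int k - int l"
proof -
  define m where "m = (LEAST d. d \<in> (\<Union>a. delta_of_set (L a)))"
  define R where "R = {int k - int l | k l. \<exists>c. k \<in> L c \<and> l \<in> L c}"
  have R_add: "x + y \<in> R" if "x \<in> R" "y \<in> R" for x y
  proof -
    from that obtain k l c k' l' c' where "x = int k - int l" "k \<in> L c" "l \<in> L c"
      "y = int k' - int l'" "k' \<in> L c'" "l' \<in> L c'" unfolding R_def by blast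
    then show ?thesis unfolding R_def using add
      by (intro CollectI exI[of _ "k + k'"] exI[of _ "l + l'"] conjI exI[of _ "c + c'"]) auto
  qed
  have R_minus: "- x \<in> R" if "x \<in> R" for x
  proof -
    from that obtain k l c where "x = int k - int l" "k \<in> L c" "l \<in> L c" unfolding R_def by blast
    then show ?thesis unfolding R_def by (intro CollectI exI[of _ l] exI[of _ k]) auto
  qed
  have R0: "0 \<in> R" unfolding R_def using kl by force
  have R_nat: "int n * x \<in> R" if "x \<in> R" for n x
    using that by (induction n) (auto simp: R0 algebra_simps intro: R_add)
  have R_int: "n * x \<in> R" if "x \<in> R" for n x
    using R_nat[OF that, of "nat n"] R_minus[OF R_nat[OF that, of "nat (- n)"]]
    by (cases "n \<ge> 0") auto
  have m: "m \<in> (\<Union>a. delta_of_set (L a))"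
    unfolding m_def using ne by (intro LeastI_ex[of "\<lambda>d. d \<in> (\<Union>a. delta_of_set (L a))"]) blast
  then obtain a x y where xy: "x \<in> L a" "y \<in> L a" "x < y" "m = y - x"
    unfolding delta_of_set_def by blast
  then have "m > 0" and "int m = int y - int x" by (auto simp: of_nat_diff)
  then have mR: "int m \<in> R" unfolding R_def using xy by blast
  define q where "q = (int k - int l) div int m"
  define r where "r = (int k - int l) mod int m"
  have "int k - int l \<in> R" using kl unfolding R_def by auto
  then have "(int k - int l) + (- q) * int m \<in> R" using R_int[OF mR] by (intro R_add)
  then have "r \<in> R" unfolding q_def r_def by (simp add: minus_div_mult_eq_mod)
  then obtain k' l' c where c: "r = int k' - int l'" "k' \<in> L c" "l' \<in> L c"
    unfolding R_def by blast
  have "r = 0"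
  proof (rule ccontr)
    assume "r \<noteq> 0"
    moreover have "0 \<le> r" "r < int m" using \<open>m > 0\<close> unfolding r_def by simp_all
    ultimately have "0 < r" "r < int m" by simp_all
    with c have "l' < k'" "k' - l' < m" by auto
    with delta_of_set_between[OF c(2,3)] obtain d where "d \<in> delta_of_set (L c)" "d < m"
      by (meson le_less_trans)
    then show False using not_less_Least[of d "\<lambda>d. d \<in> (\<Union>a. delta_of_set (L a))"]
      unfolding m_def by blast
  qed
  then show ?thesis unfolding m_def[symmetric] r_def by (simp add: dvd_eq_mod_eq_0)
qed

section \<open>Groups of odd prime exponent\<close>

locale odd_elementary_group = comm_group G for G (structure) +
  fixes p :: nat
  assumes prime_p: "Factorial_Ring.prime p" and odd_p: "odd p"
    and exponent: "x \<in> carrier G \<Longrightarrow> x [^] p = \<one>"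
begin

lemma p_ge_3: "p \<ge> 3"
proof -
  have "p \<noteq> 2" using odd_p by auto
  with prime_ge_2_nat[OF prime_p] show ?thesis by linarith
qed

lemma int_pow_eq_one_iff:
  assumes "x \<in> carrier G" "x \<noteq> \<one>"
  shows "x [^] (k::int) = \<one> \<longleftrightarrow> int p dvd k"
proof -
  have "ord x dvd p" using assms exponent pow_eq_id by blast
  moreover have "ord x \<noteq> 1" using assms ord_eq_1 by blast
  ultimately have "ord x = p" using prime_p by (metis prime_nat_iff)
  then show ?thesis using int_pow_eq_id[OF assms(1)] by simp
qed

text \<open>The weight of \<open>x\<close> must be a multiple of \<open>p\<close> with absolute
  value at most \<open>n\<close> and the parity of \<open>n\<close>: 0 serves for even
  \<open>n\<close>, and \<open>p\<close> for odd \<open>n \<ge> p\<close>.\<close>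

lemma pm_zero_sum_replicate_iff_prime:
  assumes "x \<in> carrier G" "x \<noteq> \<one>"
  shows "pm_zero_sum G (replicate_mset n x) \<longleftrightarrow> even n \<or> p \<le> n"
proof -
  have "(\<exists>t. signed_count n t \<and> int p dvd t) \<longleftrightarrow> even n \<or> p \<le> n"
  proof
    assume "\<exists>t. signed_count n t \<and> int p dvd t"
    then obtain t where t: "\<bar>t\<bar> \<le> int n" "even (int n - t)" "int p dvd t"
      unfolding signed_count_def by auto
    show "even n \<or> p \<le> n"
    proof (cases "t = 0")
      case False
      then show ?thesis using dvd_imp_le_int[OF False t(3)] t(1) by simp
    qed (use t in auto)
  next
    assume "even n \<or> p \<le> n"
    then have "signed_count n 0 \<or> signed_count n (int p)"
      using odd_p by (auto simp: signed_count_def)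
    then show "\<exists>t. signed_count n t \<and> int p dvd t" by auto
  qed
  then show ?thesis
    using pm_zero_sum_replicate_iff[OF assms(1)] int_pow_eq_one_iff[OF assms] by simp
qed

text \<open>As \<open>p\<close> is odd, one of the two factors has odd length. Being zero-sum, it
  has length at least \<open>p\<close>, which leaves nothing for the other factor.\<close>

lemma pm_atom_replicate_prime:
  assumes "x \<in> carrier G" "x \<noteq> \<one>"
  shows "pm_atom G (replicate_mset p x)"
  unfolding pm_atom_def
proof (intro conjI allI impI)
  show "replicate_mset p x \<noteq> {#}" using p_ge_3 by auto
  show "pm_zero_sum G (replicate_mset p x)"
    using pm_zero_sum_replicate_iff_prime[OF assms] by simp
  fix B C assume BC: "pm_zero_sum G B" "pm_zero_sum G C" "replicate_mset p x = B + C"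
  have "set_mset (B + C) \<subseteq> {x}" unfolding BC(3)[symmetric] by (auto simp: in_replicate_mset)
  then have "B = replicate_mset (size B) x" "C = replicate_mset (size C) x"
    using set_mset_subset_singletonD by auto
  then have "even (size B) \<or> p \<le> size B" "even (size C) \<or> p \<le> size C"
    using BC pm_zero_sum_replicate_iff_prime[OF assms] by metis+
  moreover have "size B + size C = p" using arg_cong[OF BC(3), of size] by simp
  ultimately have "size B = 0 \<or> size C = 0" using odd_p by presburger
  then show "B = {#} \<or> C = {#}" by simp
qed

lemma pm_atom_size_ge:
  assumes "pm_atom G U" "set_mset U \<subseteq> carrier G"
  shows "2 \<le> size U + count U \<one>"
proof (rule ccontr)
  assume "\<not> ?thesis"
  moreover have "size U > 0" using assms(1) by (simp add: pm_atom_def nonempty_has_size)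
  ultimately have "size U = 1" "count U \<one> = 0" by linarith+
  then obtain x where "U = {#x#}" "x \<noteq> \<one>" using size_1_singleton_mset by force
  then show False using assms pm_zero_sum_single_iff unfolding pm_atom_def by auto
qed

lemma pm_gcd_dvd:
  assumes "pm_atom G U" "set_mset U \<subseteq> A" "A \<subseteq> carrier G"
  shows "int (pm_gcd G A) dvd int (size U + count U \<one>) - 2"
proof -
  have "pm_gcd G A dvd size U + count U \<one> - 2"
    unfolding pm_gcd_def using assms by (intro Gcd_dvd) auto
  then have "int (pm_gcd G A) dvd int (size U + count U \<one> - 2)" by simp
  then show ?thesis using pm_atom_size_ge[OF assms(1)] assms by (simp add: of_nat_diff)
qed

lemma pm_gcd_dvd_prime:
  assumes "A \<subseteq> carrier G" "\<not> A \<subseteq> {\<one>}"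
  shows "pm_gcd G A dvd p - 2"
proof -
  obtain x where x: "x \<in> A" "x \<in> carrier G" "x \<noteq> \<one>" using assms by auto
  have "int (pm_gcd G A) dvd int p - 2"
    using x pm_gcd_dvd[OF pm_atom_replicate_prime _ assms(1), of x]
    by (simp add: in_replicate_mset subset_iff)
  also have "int p - 2 = int (p - 2)" using p_ge_3 by (simp add: of_nat_diff)
  finally show ?thesis by simp
qed

text \<open>Oddness is what allows a factor 2 to be cancelled in divisibilities by the gcd.\<close>

lemma odd_pm_gcd:
  assumes "A \<subseteq> carrier G" "\<not> A \<subseteq> {\<one>}"
  shows "odd (pm_gcd G A)"
proof -
  have "odd (p - 2)" using odd_p p_ge_3 by auto
  then show ?thesis using pm_gcd_dvd_prime[OF assms] dvd_trans by blast
qed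

lemma length_set_add:
  assumes "k \<in> length_set (pm_monoid G A) S" "l \<in> length_set (pm_monoid G A) T"
  shows "k + l \<in> length_set (pm_monoid G A) (S + T)"
proof -
  from assms obtain us vs where "\<forall>U\<in>set us. set_mset U \<subseteq> A \<and> pm_atom G U" "length us = k" "sum_list us = S"
    "\<forall>U\<in>set vs. set_mset U \<subseteq> A \<and> pm_atom G U" "length vs = l" "sum_list vs = T"
    unfolding length_set_pm_monoid by blast
  then show ?thesis unfolding length_set_pm_monoid
    by (intro CollectI exI[of _ "us @ vs"]) auto
qed

text \<open>Modulo \<open>pm_gcd G A\<close> every atom \<open>U\<close> has \<open>size U + count U \<one> = 2\<close>, and this weight is additive.\<close>

lemma pm_gcd_dvd_length_diff:
  assumes "A \<subseteq> carrier G" "k \<in> length_set (pm_monoid G A) S" "l \<in> length_set (pm_monoid G A) S"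
  shows "int (pm_gcd G A) dvd int k - int l"
proof -
  let ?D = "int (pm_gcd G A)"
  have len: "?D dvd int (size (sum_list us) + count (sum_list us) \<one>) - 2 * int (length us)"
    if "\<forall>U\<in>set us. set_mset U \<subseteq> A \<and> pm_atom G U" for us
    using that
  proof (induction us)
    case (Cons U us)
    have "?D dvd (int (size U + count U \<one>) - 2) +
      (int (size (sum_list us) + count (sum_list us) \<one>) - 2 * int (length us))"
      using Cons pm_gcd_dvd[OF _ _ assms(1), of U] by (intro dvd_add) auto
    then show ?case by (simp add: algebra_simps)
  qed simp
  have w: "?D dvd int (size S + count S \<one>) - 2 * int n"
    if "n \<in> length_set (pm_monoid G A) S" for n
    using that len unfolding length_set_pm_monoid by auto
  have "?D dvd 2 * (int k - int l)"
    using dvd_diff[OF w[OF assms(3)] w[OF assms(2)]] by (simp add: algebra_simps)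
  \<comment> \<open>The factor 2 is cancelled by oddness of the gcd if \<open>A\<close> has a
    nontrivial element. Otherwise the gcd is 0, and divisibility by 0 says that the difference
    vanishes.\<close>
  moreover have "?D dvd int k - int l" if "?D dvd 2 * (int k - int l)"
  proof (cases "A \<subseteq> {\<one>}")
    case True
    have "pm_gcd G A = 0"
      unfolding pm_gcd_def Gcd_0_iff
    proof (intro image_subsetI)
      fix U assume U: "U \<in> {U. set_mset U \<subseteq> A \<and> pm_atom G U}"
      then have "U \<noteq> {#}" "set_mset U \<subseteq> {\<one>}" using True by (auto simp: pm_atom_def)
      then have "\<one> \<in># U" by (metis multiset_nonemptyE singletonD subsetD)
      with U assms have "U = {#\<one>#}" using pm_atom_one_mem_iff by blast
      then show "size U + count U \<one> - 2 \<in> {0}" by simp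
    qed
    with that show ?thesis by simp
  next
    case False
    have "coprime ?D 2" using odd_pm_gcd[OF assms(1) False] by simp
    then show ?thesis using that coprime_dvd_mult_right_iff by blast
  qed
  ultimately show ?thesis by blast
qed

text \<open>A multiset outside the carrier is not a sum of atoms, so its set of lengths is empty and
  has no distances. Ranging over all multisets is the form that \<open>Least_delta_dvd\<close>
  takes.\<close>

lemma delta_set_pm_monoid:
  assumes "A \<subseteq> carrier G"
  shows "delta_set (pm_monoid G A) = (\<Union>S. delta_of_set (length_set (pm_monoid G A) S))"
proof -
  have "set_mset (sum_list us) \<subseteq> A \<and> pm_zero_sum G (sum_list us)"
    if "\<forall>U\<in>set us. set_mset U \<subseteq> A \<and> pm_atom G U" for us
    using that
  proof (induction us)
    case (Cons U us)
    then have "pm_zero_sum G U" "set_mset U \<subseteq> A" "pm_zero_sum G (sum_list us)" "set_mset (sum_list us) \<subseteq> A"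
      by (simp_all add: pm_atom_def)
    with assms show ?case by (simp add: pm_zero_sum_add subset_trans[OF _ assms])
  qed simp
  then have "S \<in> carrier (pm_monoid G A)" if "length_set (pm_monoid G A) S \<noteq> {}" for S
    using that unfolding length_set_pm_monoid carrier_pm_monoid by blast
  then have "delta_of_set (length_set (pm_monoid G A) S) = {}" if "S \<notin> carrier (pm_monoid G A)" for S
    using that by (cases "length_set (pm_monoid G A) S = {}") (auto simp: delta_of_set_def)
  then show ?thesis unfolding delta_set_def by blast
qed

lemma length_set_square:
  assumes "set_mset U \<subseteq> A - {\<one>}" "A \<subseteq> carrier G" "pm_atom G U"
  shows "2 \<in> length_set (pm_monoid G A) (U + U)" "size U \<in> length_set (pm_monoid G A) (U + U)"
proof -
  show "2 \<in> length_set (pm_monoid G A) (U + U)"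
    unfolding length_set_pm_monoid using assms by (intro CollectI exI[of _ "[U, U]"]) auto
  obtain gs where gs: "mset gs = U" using ex_mset by blast
  let ?us = "map (\<lambda>g. {#g, g#}) gs"
  have "sum_list ?us = mset gs + mset gs" by (induction gs) auto
  moreover have "set_mset V \<subseteq> A \<and> pm_atom G V" if "V \<in> set ?us" for V
    using that gs assms by (auto intro!: pm_atom_square)
  ultimately show "size U \<in> length_set (pm_monoid G A) (U + U)"
    unfolding length_set_pm_monoid using gs by (intro CollectI exI[of _ ?us]) auto
qed

text \<open>For nontrivial \<open>x\<close> in \<open>A\<close>, the square of the atom of
  \<open>p\<close> copies of \<open>x\<close> has the lengths 2 and \<open>p \<ge> 3\<close>. Over
  \<open>{\<one>}\<close> the only possible atom is \<open>{#\<one>#}\<close>, so the size of a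
  sequence is its only possible length.\<close>

lemma delta_set_pm_monoid_nonempty_iff:
  assumes "A \<subseteq> carrier G"
  shows "delta_set (pm_monoid G A) \<noteq> {} \<longleftrightarrow> \<not> A \<subseteq> {\<one>}"
proof
  assume "\<not> A \<subseteq> {\<one>}"
  then obtain x where x: "x \<in> A" "x \<in> carrier G" "x \<noteq> \<one>" using assms by auto
  then have "set_mset (replicate_mset p x) \<subseteq> A - {\<one>}" by (auto simp: in_replicate_mset)
  from length_set_square[OF this assms pm_atom_replicate_prime[OF x(2,3)]]
  show "delta_set (pm_monoid G A) \<noteq> {}"
    unfolding delta_set_pm_monoid[OF assms]
    using delta_of_set_between[of p _ 2] p_ge_3 by fastforce
next
  assume "delta_set (pm_monoid G A) \<noteq> {}"
  then obtain S k l where kl: "k \<in> length_set (pm_monoid G A) S" "l \<in> length_set (pm_monoid G A) S" "l < k"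
    unfolding delta_set_pm_monoid[OF assms] delta_of_set_def by auto
  show "\<not> A \<subseteq> {\<one>}"
  proof
    assume A: "A \<subseteq> {\<one>}"
    have one: "U = {#\<one>#}" if "set_mset U \<subseteq> A" "pm_atom G U" for U
    proof -
      have "\<one> \<in># U" using that A by (metis multiset_nonemptyE singletonD subsetD pm_atom_def)
      then show ?thesis using that assms pm_atom_one_mem_iff by blast
    qed
    have "size (sum_list us) = length us" if "\<forall>U\<in>set us. set_mset U \<subseteq> A \<and> pm_atom G U" for us
      using that by (induction us) (auto dest!: one)
    then have "n = size S" if "n \<in> length_set (pm_monoid G A) S" for n
      using that unfolding length_set_pm_monoid by auto
    then show False using kl by auto
  qed
qed

text \<open>The least distance divides the difference of the lengths 2 and \<open>size U\<close> of
  \<open>U + U\<close>, hence the gcd. Conversely, it is itself a difference of two lengths, so the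
  gcd divides it.\<close>

lemma Least_delta_set_pm_monoid:
  assumes "A \<subseteq> carrier G" "\<not> A \<subseteq> {\<one>}"
  shows "(LEAST d. d \<in> delta_set (pm_monoid G A)) = pm_gcd G A"
proof -
  let ?L = "length_set (pm_monoid G A)"
  define m where "m = (LEAST d. d \<in> delta_set (pm_monoid G A))"
  note \<Delta> = delta_set_pm_monoid[OF assms(1)]
  have ne: "delta_set (pm_monoid G A) \<noteq> {}"
    using delta_set_pm_monoid_nonempty_iff[OF assms(1)] assms(2) by blast
  have m_dvd: "int m dvd int k - int l" if "k \<in> ?L S" "l \<in> ?L S" for k l S
    unfolding m_def \<Delta> using Least_delta_dvd[of ?L, OF length_set_add ne[unfolded \<Delta>] that] .
  have "m dvd pm_gcd G A"
    unfolding pm_gcd_def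
  proof (intro Gcd_greatest, clarify)
    fix U assume U: "set_mset U \<subseteq> A" "pm_atom G U"
    show "m dvd size U + count U \<one> - 2"
    proof (cases "\<one> \<in># U")
      case True
      then have "U = {#\<one>#}" using U assms pm_atom_one_mem_iff by blast
      then show ?thesis by simp
    next
      case False
      then have "int m dvd int (size U) - int 2"
        using length_set_square[of U A] U assms by (intro m_dvd[of _ "U + U"]) auto
      moreover have "2 \<le> size U" using pm_atom_size_ge[of U] U assms False
        by (simp add: not_in_iff)
      ultimately have "int m dvd int (size U - 2)" by (simp add: of_nat_diff)
      then show ?thesis using False by (simp add: not_in_iff)
    qed
  qed
  moreover have "pm_gcd G A dvd m"
  proof -
    have "m \<in> delta_set (pm_monoid G A)"
      unfolding m_def using ne by (intro LeastI_ex[of "\<lambda>d. d \<in> delta_set (pm_monoid G A)"]) blast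
    then obtain S a b where "a \<in> ?L S" "b \<in> ?L S" "a < b" "m = b - a"
      unfolding \<Delta> delta_of_set_def by auto
    then have "int (pm_gcd G A) dvd int m"
      using pm_gcd_dvd_length_diff[OF assms(1), of b S a] by (simp add: of_nat_diff)
    then show ?thesis by simp
  qed
  ultimately show ?thesis unfolding m_def[symmetric] by (rule dvd_antisym)
qed

text \<open>A divisor-closed submonoid contains \<open>g\<^sup>2\<close> for each \<open>g\<close> in its support, hence \<open>T\<^sup>2\<close> and its
  divisor \<open>T\<close> for every \<open>T\<close> over the support.\<close>

lemma divisor_closed_submonoid_pm_monoid_iff:
  "divisor_closed_submonoid M (pm_monoid G (carrier G)) \<longleftrightarrow>
    (\<exists>A\<subseteq>carrier G. M = {S. set_mset S \<subseteq> A \<and> pm_zero_sum G S})"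
proof
  assume "\<exists>A\<subseteq>carrier G. M = {S. set_mset S \<subseteq> A \<and> pm_zero_sum G S}"
  then obtain A where A: "A \<subseteq> carrier G" and M: "M = {S. set_mset S \<subseteq> A \<and> pm_zero_sum G S}" by blast
  have "submonoid M (pm_monoid G (carrier G))"
    using A by unfold_locales (auto simp: pm_monoid_def M intro: pm_zero_sum_add)
  then show "divisor_closed_submonoid M (pm_monoid G (carrier G))"
    unfolding divisor_closed_submonoid_def by (auto simp: pm_monoid_def M factor_def)
next
  assume dc: "divisor_closed_submonoid M (pm_monoid G (carrier G))"
  then have sub: "submonoid M (pm_monoid G (carrier G))"
    by (simp add: divisor_closed_submonoid_def)
  have M: "S \<in> M \<Longrightarrow> set_mset S \<subseteq> carrier G \<and> pm_zero_sum G S" for S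
    using submonoid.subset[OF sub] by (auto simp: pm_monoid_def)
  have plus: "S + T \<in> M" if "S \<in> M" "T \<in> M" for S T
    using submonoid.m_closed[OF sub] that by (simp add: pm_monoid_def)
  have empty: "{#} \<in> M" using submonoid.one_closed[OF sub] by (simp add: pm_monoid_def)
  have div: "B \<in> M" if "B + C \<in> M" "pm_zero_sum G B" "pm_zero_sum G C" for B C
  proof -
    have "set_mset (B + C) \<subseteq> carrier G" using M that by blast
    then show ?thesis
      using dc that unfolding divisor_closed_submonoid_def
      by (auto simp: pm_monoid_def factor_def)
  qed
  let ?A = "\<Union>S\<in>M. set_mset S"
  have square: "{#g, g#} \<in> M" if "g \<in> ?A" for g
  proof -
    from that obtain S where S: "S \<in> M" "g \<in># S" by blast
    then obtain T where T: "S = add_mset g T" by (metis multi_member_split)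
    have "set_mset S \<subseteq> carrier G" using M S by blast
    \<comment> \<open>Divisibility inside the monoid requires a zero-sum cofactor: in
      \<open>S + S\<close> the cofactor of \<open>{#g, g#}\<close> is the square
      \<open>T + T\<close>.\<close>
    then have "pm_zero_sum G {#g, g#}" "pm_zero_sum G (T + T)"
      using pm_zero_sum_double[of "{#g#}"] pm_zero_sum_double[of T] T by auto
    moreover have "{#g, g#} + (T + T) \<in> M" using plus[OF S(1) S(1)] T by simp
    ultimately show ?thesis using div by blast
  qed
  have dbl: "T + T \<in> M" if "set_mset T \<subseteq> ?A" for T
    using that
  proof (induction T)
    case (add g T)
    then have "T + T \<in> M" "g \<in> ?A" by simp_all
    from plus[OF square[OF this(2)] this(1)] show ?case by simp
  qed (simp add: empty)
  have "M = {S. set_mset S \<subseteq> ?A \<and> pm_zero_sum G S}"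
    using M div dbl by blast
  moreover have "?A \<subseteq> carrier G" using M by blast
  ultimately show "\<exists>A\<subseteq>carrier G. M = {S. set_mset S \<subseteq> A \<and> pm_zero_sum G S}" by blast
qed

text \<open>The only atom that contains the identity contributes 0 to the gcd.\<close>

lemma pm_gcd_diff_one:
  assumes "A \<subseteq> carrier G" shows "pm_gcd G (A - {\<one>}) = pm_gcd G A"
proof (rule dvd_antisym)
  show "pm_gcd G A dvd pm_gcd G (A - {\<one>})"
    unfolding pm_gcd_def by (intro Gcd_greatest) (auto intro!: Gcd_dvd)
  show "pm_gcd G (A - {\<one>}) dvd pm_gcd G A"
    unfolding pm_gcd_def[of G A]
  proof (intro Gcd_greatest, clarify)
    fix U assume U: "set_mset U \<subseteq> A" "pm_atom G U"
    show "pm_gcd G (A - {\<one>}) dvd size U + count U \<one> - 2"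
    proof (cases "\<one> \<in># U")
      case True
      then have "U = {#\<one>#}" using U assms pm_atom_one_mem_iff by blast
      then show ?thesis by simp
    next
      case False
      then show ?thesis unfolding pm_gcd_def using U by (intro Gcd_dvd) auto
    qed
  qed
qed

lemma delta_star_pm_monoid:
  "delta_star (pm_monoid G (carrier G)) = pm_gcd G ` {A. A \<subseteq> carrier G - {\<one>} \<and> A \<noteq> {}}"
proof -
  have upd: "(pm_monoid G (carrier G))\<lparr>carrier := {S. set_mset S \<subseteq> A \<and> pm_zero_sum G S}\<rparr> =
      pm_monoid G A" for A
    by (simp add: pm_monoid_def)
  have "delta_star (pm_monoid G (carrier G)) =
      {LEAST d. d \<in> delta_set (pm_monoid G A) |A. A \<subseteq> carrier G \<and> delta_set (pm_monoid G A) \<noteq> {}}"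
    (is "?L = ?R")
  proof (intro equalityI subsetI)
    fix d assume "d \<in> ?L"
    then obtain M A where "A \<subseteq> carrier G" and M: "M = {S. set_mset S \<subseteq> A \<and> pm_zero_sum G S}"
      and "delta_set ((pm_monoid G (carrier G))\<lparr>carrier := M\<rparr>) \<noteq> {}"
      and "d = (LEAST d. d \<in> delta_set ((pm_monoid G (carrier G))\<lparr>carrier := M\<rparr>))"
      unfolding delta_star_def divisor_closed_submonoid_pm_monoid_iff by blast
    then show "d \<in> ?R" unfolding M upd by blast
  next
    fix d assume "d \<in> ?R"
    then obtain A where "A \<subseteq> carrier G" "delta_set (pm_monoid G A) \<noteq> {}"
      "d = (LEAST d. d \<in> delta_set (pm_monoid G A))" by blast
    then show "d \<in> ?L"
      unfolding delta_star_def divisor_closed_submonoid_pm_monoid_iff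
      by (intro CollectI exI[of _ "{S. set_mset S \<subseteq> A \<and> pm_zero_sum G S}"]) (auto simp: upd)
  qed
  also have "\<dots> = {LEAST d. d \<in> delta_set (pm_monoid G A) |A. A \<subseteq> carrier G \<and> \<not> A \<subseteq> {\<one>}}"
    using delta_set_pm_monoid_nonempty_iff by (intro Collect_cong ex_cong1 conj_cong) (simp_all del: subset_singleton_iff)
  also have "\<dots> = pm_gcd G ` {A. A \<subseteq> carrier G \<and> \<not> A \<subseteq> {\<one>}}"
    unfolding setcompr_eq_image
    using Least_delta_set_pm_monoid by (intro image_cong) (simp_all del: subset_singleton_iff)
  also have "\<dots> = pm_gcd G ` {A. A \<subseteq> carrier G - {\<one>} \<and> A \<noteq> {}}"
  proof (intro equalityI image_subsetI)
    fix A assume "A \<in> {A. A \<subseteq> carrier G \<and> \<not> A \<subseteq> {\<one>}}"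
    then show "pm_gcd G A \<in> pm_gcd G ` {A. A \<subseteq> carrier G - {\<one>} \<and> A \<noteq> {}}"
      using pm_gcd_diff_one[of A] by (intro image_eqI[of _ _ "A - {\<one>}"]) auto
  next
    fix A assume "A \<in> {A. A \<subseteq> carrier G - {\<one>} \<and> A \<noteq> {}}"
    then show "pm_gcd G A \<in> pm_gcd G ` {A. A \<subseteq> carrier G \<and> \<not> A \<subseteq> {\<one>}}"
      by (intro imageI) blast
  qed
  finally show ?thesis .
qed

end


section \<open>Independent families\<close>

lemma count_image_mset_inj_on:
  assumes "inj_on f Y" "set_mset U \<subseteq> Y" "x \<in> Y"
  shows "count (image_mset f U) (f x) = count U x"
proof -
  have "f -` {f x} \<inter> set_mset U = (if x \<in># U then {x} else {})"
    using assms by (auto simp: inj_on_eq_iff subset_iff)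
  then show ?thesis by (simp add: count_image_mset not_in_iff)
qed

context odd_elementary_group
begin

section \<open>Transport along injective homomorphisms\<close>

lemma hom_finprod:
  assumes "group_hom H G h" "comm_group H" "finite A" "f \<in> A \<rightarrow> carrier H"
  shows "h (finprod H f A) = finprod G (\<lambda>x. h (f x)) A"
proof -
  interpret H: comm_group H by fact
  interpret h: group_hom H G h by fact
  show ?thesis using assms(3,4)
    by (induction A rule: finite_induct) (auto simp: Pi_iff)
qed

text \<open>Injectivity keeps all multiplicities and reflects the identity, and \<open>h\<close>
  maps the weighted product over \<open>U\<close> to the one over its image. So the same weights
  work on both sides.\<close>

lemma pm_zero_sum_image_iff:
  assumes hom: "group_hom H G h" "comm_group H" and inj: "inj_on h (carrier H)"
    and U: "set_mset U \<subseteq> carrier H"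
  shows "pm_zero_sum G (image_mset h U) \<longleftrightarrow> pm_zero_sum H U"
proof -
  interpret H: comm_group H by fact
  interpret h: group_hom H G h by fact
  let ?A = "set_mset U"
  have injA: "inj_on h ?A" using inj U inj_on_subset by blast
  have hA: "h g \<in> carrier G" if "g \<in> ?A" for g using that U by auto
  have prod: "(\<Otimes>x\<in>h ` ?A. x [^] t x) = h (\<Otimes>\<^bsub>H\<^esub>g\<in>?A. g [^]\<^bsub>H\<^esub> t (h g))" for t :: "'a \<Rightarrow> int"
  proof -
    have "(\<Otimes>x\<in>h ` ?A. x [^] t x) = (\<Otimes>g\<in>?A. h g [^] t (h g))"
      using injA hA by (intro finprod_reindex) auto
    also have "\<dots> = (\<Otimes>g\<in>?A. h (g [^]\<^bsub>H\<^esub> t (h g)))"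
      using U by (intro finprod_cong') (auto simp: h.hom_int_pow)
    also have "\<dots> = h (\<Otimes>\<^bsub>H\<^esub>g\<in>?A. g [^]\<^bsub>H\<^esub> t (h g))"
      using U by (intro hom_finprod[OF hom, symmetric]) auto
    finally show ?thesis .
  qed
  have one: "h x = \<one> \<longleftrightarrow> x = \<one>\<^bsub>H\<^esub>" if "x \<in> carrier H" for x
    using inj_on_eq_iff[OF inj that H.one_closed] by simp
  have cl: "(\<Otimes>\<^bsub>H\<^esub>g\<in>?A. g [^]\<^bsub>H\<^esub> t g) \<in> carrier H" for t :: "'c \<Rightarrow> int"
    using U by (intro H.finprod_closed) auto
  have cnt: "count (image_mset h U) (h g) = count U g" if "g \<in> ?A" for g
    using count_image_mset_inj_on[OF injA _ that] by simp
  have "pm_zero_sum G (image_mset h U) \<longleftrightarrow>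
      (\<exists>t. (\<forall>x\<in>h ` ?A. signed_count (count (image_mset h U) x) (t x)) \<and> (\<Otimes>x\<in>h ` ?A. x [^] t x) = \<one>)"
    using hA by (intro pm_zero_sum_iff_weights) auto
  also have "\<dots> \<longleftrightarrow> (\<exists>t :: 'a \<Rightarrow> int. (\<forall>g\<in>?A. signed_count (count U g) (t (h g))) \<and>
      (\<Otimes>\<^bsub>H\<^esub>g\<in>?A. g [^]\<^bsub>H\<^esub> t (h g)) = \<one>\<^bsub>H\<^esub>)"
    unfolding prod one[OF cl] using cnt by simp
  also have "\<dots> \<longleftrightarrow> (\<exists>t. (\<forall>g\<in>?A. signed_count (count U g) (t g)) \<and>
      (\<Otimes>\<^bsub>H\<^esub>g\<in>?A. g [^]\<^bsub>H\<^esub> t g) = \<one>\<^bsub>H\<^esub>)" (is "_ \<longleftrightarrow> ?R")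
  proof
    assume ?R
    then obtain t where t: "\<forall>g\<in>?A. signed_count (count U g) (t g)"
      "(\<Otimes>\<^bsub>H\<^esub>g\<in>?A. g [^]\<^bsub>H\<^esub> t g) = \<one>\<^bsub>H\<^esub>" by blast
    let ?t = "\<lambda>x. t (inv_into ?A h x)"
    have "(\<Otimes>\<^bsub>H\<^esub>g\<in>?A. g [^]\<^bsub>H\<^esub> ?t (h g)) = (\<Otimes>\<^bsub>H\<^esub>g\<in>?A. g [^]\<^bsub>H\<^esub> t g)"
      using U injA by (intro H.finprod_cong') auto
    then show "\<exists>t :: 'a \<Rightarrow> int. (\<forall>g\<in>?A. signed_count (count U g) (t (h g))) \<and>
        (\<Otimes>\<^bsub>H\<^esub>g\<in>?A. g [^]\<^bsub>H\<^esub> t (h g)) = \<one>\<^bsub>H\<^esub>"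
      using t injA by (intro exI[of _ ?t]) simp
  next
    assume "\<exists>t :: 'a \<Rightarrow> int. (\<forall>g\<in>?A. signed_count (count U g) (t (h g))) \<and>
        (\<Otimes>\<^bsub>H\<^esub>g\<in>?A. g [^]\<^bsub>H\<^esub> t (h g)) = \<one>\<^bsub>H\<^esub>"
    then obtain t :: "'a \<Rightarrow> int" where "\<forall>g\<in>?A. signed_count (count U g) (t (h g))"
      "(\<Otimes>\<^bsub>H\<^esub>g\<in>?A. g [^]\<^bsub>H\<^esub> t (h g)) = \<one>\<^bsub>H\<^esub>" by blast
    then show ?R by (intro exI[of _ "\<lambda>g. t (h g)"] conjI)
  qed
  also have "\<dots> \<longleftrightarrow> pm_zero_sum H U"
    using U by (intro H.pm_zero_sum_iff_weights[symmetric]) auto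
  finally show ?thesis .
qed

lemma pm_atom_image_iff:
  assumes hom: "group_hom H G h" "comm_group H" and inj: "inj_on h (carrier H)"
    and U: "set_mset U \<subseteq> carrier H"
  shows "pm_atom G (image_mset h U) \<longleftrightarrow> pm_atom H U"
proof
  assume atom: "pm_atom G (image_mset h U)"
  show "pm_atom H U" unfolding pm_atom_def
  proof (intro conjI allI impI)
    show "U \<noteq> {#}" "pm_zero_sum H U"
      using atom pm_zero_sum_image_iff[OF assms] by (auto simp: pm_atom_def)
    fix B C assume BC: "pm_zero_sum H B" "pm_zero_sum H C" "U = B + C"
    then have "pm_zero_sum G (image_mset h B)" "pm_zero_sum G (image_mset h C)"
      using U by (auto simp: pm_zero_sum_image_iff[OF hom inj])
    moreover have "image_mset h U = image_mset h B + image_mset h C" using BC by simp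
    ultimately show "B = {#} \<or> C = {#}" using atom unfolding pm_atom_def by (metis image_mset_is_empty_iff)
  qed
next
  assume atom: "pm_atom H U"
  show "pm_atom G (image_mset h U)" unfolding pm_atom_def
  proof (intro conjI allI impI)
    show "image_mset h U \<noteq> {#}" "pm_zero_sum G (image_mset h U)"
      using atom pm_zero_sum_image_iff[OF assms] by (auto simp: pm_atom_def)
    fix B' C' assume BC: "pm_zero_sum G B'" "pm_zero_sum G C'" "image_mset h U = B' + C'"
    obtain B C where U': "U = B + C" "B' = image_mset h B" "C' = image_mset h C"
      using image_mset_eq_plusD[OF BC(3)] by blast
    with BC U have "pm_zero_sum H B" "pm_zero_sum H C"
      by (auto simp: pm_zero_sum_image_iff[OF hom inj])
    then show "B' = {#} \<or> C' = {#}" using atom U' unfolding pm_atom_def by auto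
  qed
qed

text \<open>This moves the gcd of a set on a line back to the cyclic group of order
  \<open>p\<close>. Atoms correspond under \<open>h\<close>, with equal sizes and equal
  multiplicities of the identity.\<close>

lemma pm_gcd_image:
  assumes hom: "group_hom H G h" "comm_group H" and inj: "inj_on h (carrier H)"
    and A: "A \<subseteq> carrier H"
  shows "pm_gcd G (h ` A) = pm_gcd H A"
proof -
  interpret H: comm_group H by fact
  interpret h: group_hom H G h by fact
  have U: "{U. set_mset U \<subseteq> h ` A \<and> pm_atom G U} = image_mset h ` {U. set_mset U \<subseteq> A \<and> pm_atom H U}"
  proof (intro equalityI subsetI)
    fix V assume V: "V \<in> {U. set_mset U \<subseteq> h ` A \<and> pm_atom G U}"
    let ?U = "image_mset (inv_into A h) V"
    have "image_mset h ?U = image_mset (\<lambda>x. x) V"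
      unfolding multiset.map_comp using V
      by (intro image_mset_cong) (auto intro: f_inv_into_f)
    then have V': "V = image_mset h ?U" by simp
    have sub: "set_mset ?U \<subseteq> A" using V by (auto intro: inv_into_into)
    then have "pm_atom H ?U" using V V' pm_atom_image_iff[OF hom inj, of ?U] A by auto
    with V' sub show "V \<in> image_mset h ` {U. set_mset U \<subseteq> A \<and> pm_atom H U}" by blast
  next
    fix V assume "V \<in> image_mset h ` {U. set_mset U \<subseteq> A \<and> pm_atom H U}"
    then obtain U where "V = image_mset h U" "set_mset U \<subseteq> A" "pm_atom H U" by blast
    then show "V \<in> {U. set_mset U \<subseteq> h ` A \<and> pm_atom G U}"
      using pm_atom_image_iff[OF hom inj, of U] A by auto
  qed
  have "size (image_mset h U) + count (image_mset h U) \<one> - 2 = size U + count U \<one>\<^bsub>H\<^esub> - 2"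
    if "set_mset U \<subseteq> A" for U
    using count_image_mset_inj_on[OF inj, of U "\<one>\<^bsub>H\<^esub>"] that A by auto
  then have "(\<lambda>U. size U + count U \<one> - 2) ` {U. set_mset U \<subseteq> h ` A \<and> pm_atom G U} =
      (\<lambda>U. size U + count U \<one>\<^bsub>H\<^esub> - 2) ` {U. set_mset U \<subseteq> A \<and> pm_atom H U}"
    unfolding U image_image by (intro image_cong) auto
  then show ?thesis by (simp add: pm_gcd_def)
qed

section \<open>Lines and independence over the field with p elements\<close>

lemma group_hom_int_pow:
  assumes "x \<in> carrier G"
  shows "group_hom (integer_mod_group p) G (\<lambda>k. x [^] k)"
proof (intro group_hom.intro group_hom_axioms.intro homI)
  fix k l assume "k \<in> carrier (integer_mod_group p)" "l \<in> carrier (integer_mod_group p)"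
  \<comment> \<open>Reduction modulo \<open>p\<close> subtracts a multiple of \<open>p\<close> from
    the exponent, which does no harm since \<open>x\<close> to the power \<open>p\<close> is
    trivial.\<close>
  have "x [^] ((k + l) mod int p) = x [^] (k + l - int p * ((k + l) div int p))"
    by (simp add: minus_mult_div_eq_mod)
  also have "\<dots> = x [^] (k + l) \<otimes> inv ((x [^] int p) [^] ((k + l) div int p))"
    using assms by (simp add: int_pow_diff int_pow_pow)
  also have "x [^] int p = \<one>" using exponent[OF assms] by (simp add: int_pow_int)
  finally show "x [^] (k \<otimes>\<^bsub>integer_mod_group p\<^esub> l) = x [^] k \<otimes> x [^] l"
    using assms by (simp add: int_pow_mult)
qed (use assms in auto)

lemma inj_on_int_pow:
  assumes "x \<in> carrier G" "x \<noteq> \<one>"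
  shows "inj_on (\<lambda>k. x [^] k) (carrier (integer_mod_group p))"
proof (intro inj_onI)
  fix k l assume kl: "k \<in> carrier (integer_mod_group p)" "l \<in> carrier (integer_mod_group p)"
    and eq: "x [^] k = x [^] l"
  have "x [^] (k - l) = \<one>" using eq assms by (simp add: int_pow_diff)
  then have "int p dvd k - l" using int_pow_eq_one_iff[OF assms] by blast
  moreover have "\<bar>k - l\<bar> < int p" using kl p_ge_3 by (auto simp: carrier_integer_mod_group split: if_splits)
  ultimately show "k = l" using dvd_imp_le_int[of "k - l" "int p"] by force
qed

text \<open>Linear independence over the field with \<open>p\<close> elements, with integers as
  representatives of the coefficients. Indexed families cover both the unit vectors, indexed by
  coordinates, and subsets of the group, indexed by themselves.\<close>

definition independent :: "('i \<Rightarrow> 'a) \<Rightarrow> 'i set \<Rightarrow> bool" where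
  "independent e I \<longleftrightarrow> finite I \<and> e \<in> I \<rightarrow> carrier G \<and>
     (\<forall>c :: 'i \<Rightarrow> int. (\<Otimes>i\<in>I. e i [^] c i) = \<one> \<longrightarrow> (\<forall>i\<in>I. int p dvd c i))"

lemma independentD:
  fixes e :: "'i \<Rightarrow> 'a"
  assumes "independent e I" "(\<Otimes>i\<in>I. e i [^] c i) = \<one>" "i \<in> I"
  shows "int p dvd c i"
  using assms unfolding independent_def by blast

lemma independent_not_one:
  fixes e :: "'i \<Rightarrow> 'a"
  assumes "independent e I" "i \<in> I" shows "e i \<noteq> \<one>"
proof
  assume "e i = \<one>"
  then have "(\<Otimes>j\<in>I. e j [^] (if j = i then 1 else (0::int))) = \<one>"
    using assms by (subst finprod_int_pow_single) (auto simp: independent_def)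
  from independentD[OF assms(1) this assms(2)] show False using p_ge_3 by simp
qed

lemma independent_subset:
  fixes e :: "'i \<Rightarrow> 'a"
  assumes "independent e I" "J \<subseteq> I" shows "independent e J"
  unfolding independent_def
proof (intro conjI allI impI)
  show "finite J" "e \<in> J \<rightarrow> carrier G"
    using assms finite_subset unfolding independent_def by auto
  fix c :: "'i \<Rightarrow> int" assume c: "(\<Otimes>i\<in>J. e i [^] c i) = \<one>"
  let ?c = "\<lambda>i. if i \<in> J then c i else 0"
  have "(\<Otimes>i\<in>J. e i [^] c i) = (\<Otimes>i\<in>I. e i [^] ?c i)"
    using assms by (intro finprod_mono_neutral_cong_left) (auto simp: independent_def Pi_iff)
  with c have "(\<Otimes>i\<in>I. e i [^] ?c i) = \<one>" by simp
  note * = independentD[OF assms(1) this]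
  show "\<forall>i\<in>J. int p dvd c i"
  proof
    fix i assume "i \<in> J"
    with *[of i] assms(2) show "int p dvd c i" by auto
  qed
qed

lemma finprod_same_int_pow:
  fixes f :: "'i \<Rightarrow> int"
  assumes "finite A" "x \<in> carrier G"
  shows "(\<Otimes>k\<in>A. x [^] f k) = x [^] (\<Sum>k\<in>A. f k)"
  using assms(1)
proof (induction A rule: finite_induct)
  case (insert a A)
  have "(\<Otimes>k\<in>insert a A. x [^] f k) = x [^] f a \<otimes> (\<Otimes>k\<in>A. x [^] f k)"
    using insert.hyps assms(2) by (intro finprod_insert) auto
  with insert assms(2) show ?case by (simp add: int_pow_mult)
qed simp

text \<open>Grouping a weighted product by lines gives a relation between the \<open>e i\<close>. By
  independence each coefficient is divisible by \<open>p\<close>, so the part on each line is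
  trivial by itself, and the given weights serve for both pieces.\<close>

lemma independent_family_split:
  assumes e: "independent e I"
    and A: "\<And>i. i \<in> I \<Longrightarrow> A i \<subseteq> carrier (integer_mod_group p) - {0}"
    and B: "\<And>i. B i = (\<lambda>k. e i [^] k) ` A i"
    and U: "set_mset U \<subseteq> (\<Union>i\<in>I. B i)" "pm_zero_sum G U" and i: "i \<in> I"
  shows "pm_zero_sum G (filter_mset (\<lambda>x. x \<in> B i) U)" "pm_zero_sum G (filter_mset (\<lambda>x. x \<notin> B i) U)"
proof -
  have I: "finite I" and ec: "\<And>i. i \<in> I \<Longrightarrow> e i \<in> carrier G" using e by (auto simp: independent_def)
  have Aint: "k \<in> {0<..<int p}" if "i \<in> I" "k \<in> A i" for i k
    using A[OF that(1)] that(2) p_ge_3 by (auto simp: carrier_integer_mod_group split: if_splits)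
  then have finA: "finite (A i)" if "i \<in> I" for i
    using that by (intro finite_subset[of "A i" "{0<..<int p}"]) auto
  then have fin: "finite (B i)" if "i \<in> I" for i using that B by simp
  have Bc: "B i \<subseteq> carrier G" if "i \<in> I" for i using that ec B by auto
  have disj: "B i \<inter> B j = {}" if ij: "i \<in> I" "j \<in> I" "i \<noteq> j" for i j
  proof (rule ccontr)
    assume "B i \<inter> B j \<noteq> {}"
    then obtain k l where kl: "k \<in> A i" "l \<in> A j" "e i [^] k = e j [^] l" using B by auto
    \<comment> \<open>A common element of two lines is a relation with coefficient \<open>k\<close>
      at \<open>i\<close> and \<open>- l\<close> at \<open>j\<close>, against
      \<open>0 < k < p\<close>.\<close>
    let ?c = "\<lambda>h. (if h = i then k else 0) + (if h = j then - l else 0)"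
    have "(\<Otimes>h\<in>I. e h [^] ?c h) = e i [^] k \<otimes> e j [^] (- l)"
      using I ij ec by (subst finprod_int_pow_add) (auto simp: finprod_int_pow_single Pi_iff)
    also have "\<dots> = \<one>" using kl ij ec by (simp add: int_pow_neg)
    finally have "(\<Otimes>h\<in>I. e h [^] ?c h) = \<one>" .
    from independentD[OF e this ij(1)] have "int p dvd k" using ij by simp
    then show False using Aint[OF ij(1) kl(1)] zdvd_imp_le by force
  qed
  let ?B = "\<Union>i\<in>I. B i"
  have finB: "finite ?B" and cB: "?B \<subseteq> carrier G" using I fin Bc by auto
  obtain t where t: "\<forall>g\<in>?B. signed_count (count U g) (t g)" "(\<Otimes>g\<in>?B. g [^] t g) = \<one>"
    using pm_zero_sum_iff_weights[OF finB cB U(1)] U(2) by blast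
  \<comment> \<open>The total exponent of \<open>e i\<close> collected from all terms on its
    line.\<close>
  define c where "c i = (\<Sum>k\<in>A i. k * t (e i [^] k))" for i
  have part: "(\<Otimes>g\<in>B i. g [^] t g) = e i [^] c i" if i: "i \<in> I" for i
  proof -
    have "inj_on (\<lambda>k. e i [^] k) (A i)"
      using inj_on_int_pow[OF ec[OF i] independent_not_one[OF e i]] A[OF i] inj_on_subset by blast
    then have "(\<Otimes>g\<in>B i. g [^] t g) = (\<Otimes>k\<in>A i. (e i [^] k) [^] t (e i [^] k))"
      unfolding B using ec[OF i] by (intro finprod_reindex) auto
    also have "\<dots> = (\<Otimes>k\<in>A i. e i [^] (k * t (e i [^] k)))"
      using ec[OF i] by (intro finprod_cong') (auto simp: int_pow_pow)
    also have "\<dots> = e i [^] c i"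
      unfolding c_def using finA[OF i] ec[OF i] by (rule finprod_same_int_pow)
    finally show ?thesis .
  qed
  have "(\<Otimes>i\<in>I. e i [^] c i) = (\<Otimes>i\<in>I. \<Otimes>g\<in>B i. g [^] t g)"
    using part ec by (intro finprod_cong'[OF refl, symmetric]) auto
  also have "\<dots> = (\<Otimes>g\<in>?B. g [^] t g)"
    using I fin Bc disj
    by (intro finprod_UN_disjoint[symmetric]) (auto simp: pairwise_def disjnt_def)
  finally have "int p dvd c i" using t(2) by (intro independentD[OF e _ i]) simp
  then have Bi: "(\<Otimes>g\<in>B i. g [^] t g) = \<one>"
    using part[OF i] int_pow_eq_one_iff[OF ec[OF i] independent_not_one[OF e i]] by simp
  have Bs: "B i \<subseteq> ?B" using i by blast
  have "(\<Otimes>g\<in>B i \<union> (?B - B i). g [^] t g) = (\<Otimes>g\<in>B i. g [^] t g) \<otimes> (\<Otimes>g\<in>?B - B i. g [^] t g)"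
    using fin[OF i] finB cB Bs by (intro finprod_Un_disjoint) (auto intro!: int_pow_closed)
  moreover have "B i \<union> (?B - B i) = ?B" using Bs by blast
  moreover have "(\<Otimes>g\<in>?B - B i. g [^] t g) \<in> carrier G"
    using cB by (intro finprod_closed) (auto intro!: int_pow_closed)
  ultimately have rest: "(\<Otimes>g\<in>?B - B i. g [^] t g) = \<one>" using t(2) Bi by simp
  show "pm_zero_sum G (filter_mset (\<lambda>x. x \<in> B i) U)"
    using pm_zero_sum_iff_weights[OF fin[OF i] Bc[OF i], of "filter_mset (\<lambda>x. x \<in> B i) U"]
      t(1) Bi Bs by (auto intro!: exI[of _ t])
  have "finite (?B - B i)" "?B - B i \<subseteq> carrier G" "set_mset (filter_mset (\<lambda>x. x \<notin> B i) U) \<subseteq> ?B - B i"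
    using finB cB U(1) by auto
  from pm_zero_sum_iff_weights[OF this] show "pm_zero_sum G (filter_mset (\<lambda>x. x \<notin> B i) U)"
    using t(1) rest by (auto intro!: exI[of _ t])
qed

text \<open>Take a line that an atom meets. The part on it and the rest are both zero-sum, so the
  rest is empty. Thus the atoms over the union are those over the single lines, and each line is a
  copy of the cyclic group of order \<open>p\<close>.\<close>

lemma pm_gcd_independent_family:
  assumes e: "independent e I"
    and A: "\<And>i. i \<in> I \<Longrightarrow> A i \<subseteq> carrier (integer_mod_group p) - {0}"
  shows "pm_gcd G (\<Union>i\<in>I. (\<lambda>k. e i [^] k) ` A i) = (GCD i\<in>I. pm_gcd (integer_mod_group p) (A i))"
proof -
  define B where "B i = (\<lambda>k. e i [^] k) ` A i" for i
  have eq: "pm_gcd (integer_mod_group p) (A i) = pm_gcd G (B i)" if i: "i \<in> I" for i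
    unfolding B_def
    using A[OF i] e i independent_not_one[OF e i]
    by (intro pm_gcd_image[symmetric] group_hom_int_pow inj_on_int_pow) (auto simp: independent_def)
  have atom: "\<exists>i\<in>I. set_mset U \<subseteq> B i" if U: "set_mset U \<subseteq> (\<Union>i\<in>I. B i)" "pm_atom G U" for U
  proof -
    obtain x where x: "x \<in># U" using U(2) by (auto simp: pm_atom_def)
    then obtain i where i: "i \<in> I" "x \<in> B i" using U(1) by auto
    let ?P = "filter_mset (\<lambda>x. x \<in> B i) U" and ?Q = "filter_mset (\<lambda>x. x \<notin> B i) U"
    have "pm_zero_sum G ?P" "pm_zero_sum G ?Q"
      using independent_family_split[OF e A B_def U(1) _ i(1)] U(2) by (auto simp: pm_atom_def)
    moreover have "U = ?P + ?Q" by (rule multiset_partition)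
    moreover have "?P \<noteq> {#}" using x i by (auto simp: filter_mset_eq_conv)
    ultimately have "?Q = {#}" using U(2) unfolding pm_atom_def by blast
    then have "set_mset ?Q = {}" by simp
    then have "set_mset U \<subseteq> B i" by auto
    with i show ?thesis by blast
  qed
  \<comment> \<open>The gcd over a union and the gcd of the gcds have the same divisors.\<close>
  have "x dvd pm_gcd G (\<Union>i\<in>I. B i) \<longleftrightarrow> x dvd (GCD i\<in>I. pm_gcd G (B i))" for x
  proof -
    have "{U. set_mset U \<subseteq> (\<Union>i\<in>I. B i) \<and> pm_atom G U} = (\<Union>i\<in>I. {U. set_mset U \<subseteq> B i \<and> pm_atom G U})"
      using atom by blast
    then show ?thesis unfolding pm_gcd_def by (simp add: dvd_Gcd_iff)
  qed
  then have "pm_gcd G (\<Union>i\<in>I. B i) = (GCD i\<in>I. pm_gcd G (B i))"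
    by (metis dvd_antisym dvd_refl)
  also have "\<dots> = (GCD i\<in>I. pm_gcd (integer_mod_group p) (A i))"
    using eq by (metis (no_types, lifting) image_cong)
  finally show ?thesis unfolding B_def .
qed

end


section \<open>A dependent element with two nonzero coefficients\<close>

text \<open>The numbers \<open>t - n\<close> and \<open>t + n\<close> are even and at most
  \<open>2 * n < 2 * p\<close> in absolute value. One of them is divisible by \<open>p\<close>,
  hence by \<open>2 * p\<close>, and so is 0.\<close>

lemma signed_count_extremal:
  assumes "odd p" "n < p" "signed_count n t" "int p dvd t - int n \<or> int p dvd t + int n"
  shows "\<bar>t\<bar> = int n"
proof -
  have zero: "x = 0" if "int p dvd x" "even x" "\<bar>x\<bar> < 2 * int p" for x
  proof -
    have "coprime (int p) 2" using assms(1) by simp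
    then have "int p * 2 dvd x" using that by (intro divides_mult) auto
    then show ?thesis using that(3) dvd_imp_le_int[of x "int p * 2"] by fastforce
  qed
  from assms have "t - int n = 0 \<or> t + int n = 0"
    using zero[of "t - int n"] zero[of "t + int n"] by (auto simp: signed_count_def)
  then show ?thesis using assms(3) by auto
qed

definition star_multiset :: "'a \<Rightarrow> nat \<Rightarrow> 'a set \<Rightarrow> ('a \<Rightarrow> nat) \<Rightarrow> 'a multiset" where
  "star_multiset g m F n = replicate_mset m g + (\<Sum>e\<in>F. replicate_mset (n e) e)"

lemma count_star_multiset:
  assumes "finite F"
  shows "count (star_multiset g m F n) x = (if x = g then m else 0) + (if x \<in> F then n x else 0)"
  using assms by (auto simp: star_multiset_def count_sum if_distrib sum.delta' cong: if_cong)

lemma size_star_multiset: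
  "size (star_multiset g m F n) = m + (\<Sum>e\<in>F. n e)"
  by (simp add: star_multiset_def size_multiset_sum)

lemma set_star_multiset:
  assumes "finite F" shows "set_mset (star_multiset g m F n) \<subseteq> insert g F"
  using count_star_multiset[OF assms, of g m n] by (auto simp: set_mset_def split: if_splits)

text \<open>A circuit in the sense of matroids: all coefficients are nonzero modulo
  \<open>p\<close>, so \<open>insert g F\<close> is a minimal dependent set.\<close>

locale odd_elementary_circuit = odd_elementary_group G p for G (structure) and p +
  fixes F :: "'a set" and g :: 'a and a :: "'a \<Rightarrow> int"
  assumes indep: "independent (\<lambda>x. x) F"
    and g_notin: "g \<notin> F"
    and a_bounds: "e \<in> F \<Longrightarrow> 0 < a e \<and> a e < int p"
    and g_eq: "g = (\<Otimes>e\<in>F. e [^] a e)"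
begin

lemma finite_F: "finite F" and F_carrier: "F \<subseteq> carrier G" and g_carrier: "g \<in> carrier G"
  using indep unfolding g_eq by (auto simp: independent_def intro!: finprod_closed)

text \<open>Expanding \<open>g\<close> over \<open>F\<close> gives each \<open>e\<close> the
  exponent \<open>s * a e + t e\<close>, and independence turns triviality of the product into one
  congruence per \<open>e\<close>. The congruences are linked only through the weight
  \<open>s\<close> of \<open>g\<close>.\<close>

lemma pm_zero_sum_circuit_iff:
  assumes "set_mset U \<subseteq> insert g F"
  shows "pm_zero_sum G U \<longleftrightarrow> (\<exists>s t. signed_count (count U g) s \<and>
    (\<forall>e\<in>F. signed_count (count U e) (t e) \<and> int p dvd s * a e + t e))"
proof -
  have id: "(\<lambda>x. x) \<in> F \<rightarrow> carrier G" using F_carrier by auto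
  have prod: "(\<Otimes>x\<in>insert g F. x [^] t x) = (\<Otimes>e\<in>F. e [^] (t g * a e + t e))" for t :: "'a \<Rightarrow> int"
  proof -
    have "(\<Otimes>x\<in>insert g F. x [^] t x) = g [^] t g \<otimes> (\<Otimes>e\<in>F. e [^] t e)"
      using finite_F F_carrier g_carrier g_notin by (intro finprod_insert) auto
    also have "g [^] t g = (\<Otimes>e\<in>F. e [^] (a e * t g))"
      unfolding g_eq by (rule finprod_int_pow_pow[OF finite_F id])
    finally show ?thesis using finprod_int_pow_add[OF id, of "\<lambda>e. a e * t g" t]
      by (simp add: mult.commute)
  qed
  have one: "(\<Otimes>e\<in>F. e [^] c e) = \<one> \<longleftrightarrow> (\<forall>e\<in>F. int p dvd c e)" for c :: "'a \<Rightarrow> int"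
  proof
    assume "\<forall>e\<in>F. int p dvd c e"
    then show "(\<Otimes>e\<in>F. e [^] c e) = \<one>"
      using F_carrier int_pow_eq_one_iff independent_not_one[OF indep]
      by (intro finprod_one_eqI) blast
  qed (use independentD[OF indep] in blast)
  have "pm_zero_sum G U \<longleftrightarrow> (\<exists>t. (\<forall>x\<in>insert g F. signed_count (count U x) (t x)) \<and>
      (\<forall>e\<in>F. int p dvd t g * a e + t e))"
    using pm_zero_sum_iff_weights[OF _ _ assms] finite_F F_carrier g_carrier
    unfolding prod one by simp
  also have "\<dots> \<longleftrightarrow> (\<exists>s t. signed_count (count U g) s \<and>
    (\<forall>e\<in>F. signed_count (count U e) (t e) \<and> int p dvd s * a e + t e))" (is "?L \<longleftrightarrow> ?R")
  proof
    assume ?L then show ?R by blast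
  next
    assume ?R
    then obtain s t where st: "signed_count (count U g) s"
      "\<forall>e\<in>F. signed_count (count U e) (t e) \<and> int p dvd s * a e + t e" by blast
    have "e \<noteq> g" if "e \<in> F" for e using that g_notin by blast
    with st show ?L by (intro exI[of _ "t(g := s)"]) auto
  qed
  finally show ?thesis .
qed

text \<open>A zero-sum factor without \<open>g\<close> has weight 0, hence even multiplicity, at
  each \<open>e\<close>. The other factor then has all copies of \<open>g\<close>, with weight
  \<open>m\<close> or \<open>- m\<close>; its weight at \<open>e\<close> is congruent to
  \<open>n e\<close> up to sign, so it needs all \<open>n e\<close> copies and the first factor is
  empty. For \<open>m = 2\<close> an odd \<open>n e\<close> excludes both weight 0 for
  \<open>g\<close> and one copy of \<open>g\<close> in each factor.\<close>

lemma pm_atom_star: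
  fixes n :: "'a \<Rightarrow> nat"
  assumes m: "m \<in> {1, 2}"
    and n: "\<And>e. e \<in> F \<Longrightarrow> 0 < n e \<and> n e < p"
      "\<And>e. e \<in> F \<Longrightarrow> int p dvd int m * a e - int (n e) \<or> int p dvd int m * a e + int (n e)"
    and parity: "m = 2 \<Longrightarrow> \<exists>e\<in>F. odd (n e)"
  shows "pm_atom G (star_multiset g m F n)"
proof -
  define U where "U = star_multiset g m F n"
  have cg: "count U g = m" and ce: "\<And>e. e \<in> F \<Longrightarrow> count U e = n e"
    using g_notin by (auto simp: U_def count_star_multiset[OF finite_F])
  have setU: "set_mset U \<subseteq> insert g F" unfolding U_def by (rule set_star_multiset[OF finite_F])
  have half: "C = {#}"
    if BC: "U = B + C" "pm_zero_sum G B" "pm_zero_sum G C" "count C g = 0" for B C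
  proof -
    have sub: "set_mset B \<subseteq> insert g F" "set_mset C \<subseteq> insert g F" using setU BC(1) by auto
    have cnt: "count B e + count C e = n e" if "e \<in> F" for e using ce[OF that] BC(1) by simp
    have evenI: "even c" if "c < p" "signed_count c t" "int p dvd t" for c t
    proof -
      have "t = 0" using that dvd_imp_le_int[of t "int p"] by (force simp: signed_count_def)
      with that show ?thesis by (simp add: signed_count_def)
    qed
    obtain t where t: "\<forall>e\<in>F. signed_count (count C e) (t e) \<and> int p dvd 0 * a e + t e"
      using BC(3,4) unfolding pm_zero_sum_circuit_iff[OF sub(2)] by auto
    have Ceven: "even (count C e)" if "e \<in> F" for e
      using t that n(1)[OF that] cnt[OF that] by (intro evenI[of _ "t e"]) auto
    obtain s u where su: "signed_count m s"
      "\<forall>e\<in>F. signed_count (count B e) (u e) \<and> int p dvd s * a e + u e"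
      using BC(1,2,4) cg unfolding pm_zero_sum_circuit_iff[OF sub(1)] by auto
    have "s \<noteq> 0"
    proof
      assume "s = 0"
      with su(1) m have "m = 2" by (auto simp: signed_count_def)
      then obtain e where e: "e \<in> F" "odd (n e)" using parity by blast
      have "even (count B e)"
        using su(2) e(1) n(1)[OF e(1)] cnt[OF e(1)] \<open>s = 0\<close> by (intro evenI[of _ "u e"]) auto
      with Ceven[OF e(1)] cnt[OF e(1)] e(2) show False by presburger
    qed
    with su(1) m have s: "s = int m \<or> s = - int m" by (auto simp: signed_count_def)
    have "count C e = 0" if e: "e \<in> F" for e
    proof -
      have B: "signed_count (count B e) (u e)" "int p dvd s * a e + u e" using su(2) e by auto
      \<comment> \<open>\<open>B\<close> lacks an even number of the \<open>n e\<close> copies, so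
        passing from its multiplicity to \<open>n e\<close> keeps the parity.\<close>
      have "signed_count (n e) (u e)"
        using B(1) cnt[OF e] Ceven[OF e] unfolding signed_count_def by (auto simp flip: cnt[OF e])
      moreover have "int p dvd u e - int (n e) \<or> int p dvd u e + int (n e)"
      proof -
        consider "int p dvd int m * a e - int (n e)" | "int p dvd int m * a e + int (n e)"
          using n(2)[OF e] by blast
        then show ?thesis
        proof cases
          case 1
          then have "int p dvd (s * a e + u e) - (int m * a e - int (n e))"
            "int p dvd (s * a e + u e) + (int m * a e - int (n e))"
            using B(2) by (auto intro: dvd_diff dvd_add)
          with s show ?thesis by auto
        next
          case 2
          then have "int p dvd (s * a e + u e) - (int m * a e + int (n e))"
            "int p dvd (s * a e + u e) + (int m * a e + int (n e))"
            using B(2) by (auto intro: dvd_diff dvd_add)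
          with s show ?thesis by auto
        qed
      qed
      ultimately have "\<bar>u e\<bar> = int (n e)"
        using signed_count_extremal[OF odd_p] n(1)[OF e] by blast
      then show "count C e = 0" using B(1) cnt[OF e] by (auto simp: signed_count_def)
    qed
    then have "count C x = 0" for x
      using BC(4) sub(2) by (cases "x \<in> insert g F") (auto simp: not_in_iff)
    then show "C = {#}" by (auto intro: multiset_eqI)
  qed
  have "pm_atom G U"
    unfolding pm_atom_def
  proof (intro conjI allI impI)
    show "U \<noteq> {#}" using cg m by auto
    have "\<exists>t. signed_count (n e) t \<and> int p dvd int m * a e + t" if "e \<in> F" for e
      using n(2)[OF that]
    proof
      assume "int p dvd int m * a e - int (n e)"
      then show ?thesis by (intro exI[of _ "- int (n e)"]) (auto simp: signed_count_def)
    qed (auto intro: signed_count_self)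
    then obtain t where "\<forall>e\<in>F. signed_count (n e) (t e) \<and> int p dvd int m * a e + t e" by metis
    then show "pm_zero_sum G U"
      unfolding pm_zero_sum_circuit_iff[OF setU] cg using ce
      by (intro exI[of _ "int m"] exI[of _ t]) (auto intro: signed_count_self)
    fix B C assume BC: "pm_zero_sum G B" "pm_zero_sum G C" "U = B + C"
    then have "count B g + count C g = m" using cg by simp
    then consider "count C g = 0" | "count B g = 0" | "count B g = 1" "count C g = 1" "m = 2"
      using m by force
    then show "B = {#} \<or> C = {#}"
    proof cases
      case 1 then show ?thesis using half[OF BC(3,1,2)] by blast
    next
      case 2
      have "U = C + B" using BC(3) by (simp add: add.commute)
      from half[OF this BC(2,1) 2] show ?thesis by blast
    next
      case 3
      then obtain e where e: "e \<in> F" "odd (n e)" using parity by blast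
      have sub: "set_mset B \<subseteq> insert g F" "set_mset C \<subseteq> insert g F" using setU BC(3) by auto
      obtain s t where st: "signed_count 1 s" "signed_count (count B e) t" "int p dvd s * a e + t"
        using BC(1) e(1) unfolding pm_zero_sum_circuit_iff[OF sub(1)] 3 by blast
      obtain s' t' where st': "signed_count 1 s'" "signed_count (count C e) t'" "int p dvd s' * a e + t'"
        using BC(2) e(1) unfolding pm_zero_sum_circuit_iff[OF sub(2)] 3 by blast
      have s: "s = 1 \<or> s = - 1" "s' = 1 \<or> s' = - 1" using st(1) st'(1) by (auto simp: signed_count_def; presburger)+
      \<comment> \<open>Since \<open>s\<close> and \<open>s'\<close> are signs, they cancel in the
        difference or in the sum of the two congruences.\<close>
      have "int p dvd (s * a e + t) - (s' * a e + t')" "int p dvd (s * a e + t) + (s' * a e + t')"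
        using st(3) st'(3) by (auto intro: dvd_diff dvd_add)
      then have "int p dvd t - t' \<or> int p dvd t + t'" using s by auto
      moreover have "count B e + count C e = n e" using ce[OF e(1)] BC(3) by simp
      \<comment> \<open>The parities of \<open>t\<close> and \<open>t'\<close> are those of two
        multiplicities with odd sum \<open>n e < p\<close>. So \<open>t - t'\<close> and
        \<open>t + t'\<close> are nonzero and too small to be divisible by \<open>p\<close>.\<close>
      then have "\<bar>t - t'\<bar> < int p" "\<bar>t + t'\<bar> < int p" "odd (t - t')" "odd (t + t')"
        using st(2) st'(2) n(1)[OF e(1)] e(2) unfolding signed_count_def by (auto; presburger)+
      ultimately show ?thesis
        using dvd_imp_le_int[of "t - t'" "int p"] dvd_imp_le_int[of "t + t'" "int p"] by fastforce
    qed
  qed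
  then show ?thesis unfolding U_def .
qed

text \<open>Replacing \<open>n e2\<close> by \<open>p - n e2\<close> turns one star atom into another, so \<open>pm_gcd G A\<close> divides
  \<open>p - 2 * n e2\<close>. Take \<open>n e2 = a e2\<close> for \<open>m = 1\<close> and \<open>n e2 = 2 * a e2 mod p\<close> for \<open>m = 2\<close> (with
  \<open>n e1\<close> chosen odd); together these leave only divisors of \<open>p\<close>.\<close>

lemma pm_gcd_circuit:
  assumes A: "insert g F \<subseteq> A" "A \<subseteq> carrier G" and e: "e1 \<in> F" "e2 \<in> F" "e1 \<noteq> e2"
  shows "pm_gcd G A = 1"
proof -
  let ?D = "int (pm_gcd G A)"
  have one: "\<one> \<notin> insert g F"
  proof
    assume "\<one> \<in> insert g F"
    \<comment> \<open>Elements of \<open>F\<close> are nontrivial by independence, so only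
      \<open>g\<close> could be \<open>\<one>\<close>; that would be a relation with coefficients
      \<open>a\<close>.\<close>
    then have "g = \<one>" using independent_not_one[OF indep] by auto
    then have "int p dvd a e1" using independentD[OF indep, of a e1] g_eq e(1) by simp
    then show False using a_bounds[OF e(1)] zdvd_imp_le by force
  qed
  have dvd: "?D dvd int m + (\<Sum>e\<in>F. int (n e)) - 2"
    if "m \<in> {1, 2}" "\<And>e. e \<in> F \<Longrightarrow> 0 < n e \<and> n e < p"
      "\<And>e. e \<in> F \<Longrightarrow> int p dvd int m * a e - int (n e) \<or> int p dvd int m * a e + int (n e)"
      "m = 2 \<Longrightarrow> \<exists>e\<in>F. odd (n e)" for m and n :: "'a \<Rightarrow> nat"
  proof -
    have sub: "set_mset (star_multiset g m F n) \<subseteq> insert g F"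
      by (rule set_star_multiset[OF finite_F])
    then have "\<one> \<notin># star_multiset g m F n" using one by blast
    then have "count (star_multiset g m F n) \<one> = 0" by (simp add: not_in_iff)
    moreover have "set_mset (star_multiset g m F n) \<subseteq> A" using sub A(1) by (rule subset_trans)
    ultimately show ?thesis
      using pm_gcd_dvd[OF pm_atom_star[OF that] _ A(2)] by (simp add: size_star_multiset)
  qed
  \<comment> \<open>The odd multiplicity is demanded at \<open>e1\<close>, which the change at
    \<open>e2\<close> leaves alone; so the parity condition of \<open>pm_atom_star\<close> holds for
    both atoms.\<close>
  have swap: "?D dvd int p - 2 * int (n e2)"
    if "m \<in> {1, 2}" "\<And>e. e \<in> F \<Longrightarrow> 0 < n e \<and> n e < p"
      "\<And>e. e \<in> F \<Longrightarrow> int p dvd int m * a e - int (n e) \<or> int p dvd int m * a e + int (n e)"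
      "m = 2 \<Longrightarrow> odd (n e1)" for m and n :: "'a \<Rightarrow> nat"
  proof -
    let ?n = "n(e2 := p - n e2)"
    have "?D dvd int m + (\<Sum>e\<in>F. int (n e)) - 2" using that e by (intro dvd) auto
    moreover have "?D dvd int m + (\<Sum>e\<in>F. int (?n e)) - 2"
    proof (intro dvd)
      fix e assume "e \<in> F"
      then have n: "n e < p" "int p dvd int m * a e - int (n e) \<or> int p dvd int m * a e + int (n e)"
        using that(2,3) by auto
      \<comment> \<open>As \<open>p - n e\<close> is congruent to \<open>- n e\<close>, the
        replacement only exchanges the two alternatives of the congruence condition.\<close>
      have eq: "int m * a e - int (p - n e) = (int m * a e + int (n e)) - int p"
        "int m * a e + int (p - n e) = (int m * a e - int (n e)) + int p"
        using n(1) by (simp_all add: of_nat_diff)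
      have "int p dvd int m * a e - int (p - n e) \<or> int p dvd int m * a e + int (p - n e)"
        unfolding eq using n(2) by (blast intro: dvd_add dvd_diff dvd_refl)
      then show "int p dvd int m * a e - int (?n e) \<or> int p dvd int m * a e + int (?n e)"
        using n(2) by auto
    next
      fix e assume "e \<in> F"
      then show "0 < ?n e \<and> ?n e < p" using that(2)[of e] by auto
    qed (use that(1,4) e in auto)
    moreover have sums: "(\<Sum>e\<in>F. int (?n e)) - (\<Sum>e\<in>F. int (n e)) = int p - 2 * int (n e2)"
    proof -
      have "(\<Sum>e\<in>F - {e2}. int (?n e)) = (\<Sum>e\<in>F - {e2}. int (n e))"
        by (intro sum.cong) auto
      moreover have "int (?n e2) = int p - int (n e2)"
        using that(2)[OF e(2)] by (simp add: of_nat_diff)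
      ultimately show ?thesis
        using sum.remove[OF finite_F e(2), of "\<lambda>e. int (?n e)"]
          sum.remove[OF finite_F e(2), of "\<lambda>e. int (n e)"] by linarith
    qed
    have "int p - 2 * int (n e2) =
        (int m + (\<Sum>e\<in>F. int (?n e)) - 2) - (int m + (\<Sum>e\<in>F. int (n e)) - 2)" using sums by linarith
    ultimately show ?thesis by (simp only: dvd_diff)
  qed
  have D1: "?D dvd int p - 2 * a e2"
  proof -
    have na: "int (nat (a e)) = a e" if "e \<in> F" for e using a_bounds[OF that] by simp
    have "?D dvd int p - 2 * int (nat (a e2))"
    proof (intro swap[of 1 "\<lambda>e. nat (a e)"])
      fix e assume "e \<in> F"
      then show "0 < nat (a e) \<and> nat (a e) < p" using a_bounds[of e] by (simp add: nat_less_iff)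
      show "int p dvd int 1 * a e - int (nat (a e)) \<or> int p dvd int 1 * a e + int (nat (a e))"
        using na[OF \<open>e \<in> F\<close>] by simp
    qed simp_all
    then show ?thesis using na[OF e(2)] by simp
  qed
  define b where "b e = (2 * a e) mod int p" for e
  have b: "0 < b e \<and> b e < int p" if "e \<in> F" for e
  proof -
    have "\<not> int p dvd 2 * a e"
    proof
      assume "int p dvd 2 * a e"
      moreover have "coprime (int p) 2" using odd_p by simp
      ultimately have "int p dvd a e" using coprime_dvd_mult_right_iff by blast
      then show False using a_bounds[OF that] zdvd_imp_le by force
    qed
    then have "b e \<noteq> 0" by (simp add: b_def dvd_eq_mod_eq_0)
    moreover have "0 \<le> b e" "b e < int p" unfolding b_def using p_ge_3 by simp_all
    ultimately show ?thesis by linarith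
  qed
  have bmod: "int p dvd 2 * a e - b e" for e unfolding b_def by (simp add: minus_mod_eq_mult_div)
  \<comment> \<open>Exactly one of \<open>b e1\<close> and \<open>p - b e1\<close> is odd, since
    \<open>p\<close> is, and \<open>n e1\<close> is that one. At all other elements, in particular
    at \<open>e2\<close>, \<open>n\<close> is the residue \<open>b\<close>.\<close>
  define n where "n e = (if e = e1 \<and> even (b e) then p - nat (b e) else nat (b e))" for e
  have nb: "int (n e) = b e \<or> int (n e) = int p - b e" if "e \<in> F" for e
  proof -
    have "int (p - nat (b e)) = int p - b e" "int (nat (b e)) = b e"
      using b[OF that] by (simp_all add: of_nat_diff nat_le_iff)
    then show ?thesis unfolding n_def by presburger
  qed
  have D2: "?D dvd int p - 2 * b e2"
  proof -
    have "?D dvd int p - 2 * int (n e2)"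
    proof (intro swap[of 2 n])
      fix e assume "e \<in> F"
      show "0 < n e \<and> n e < p" using nb[OF \<open>e \<in> F\<close>] b[OF \<open>e \<in> F\<close>] by linarith
      have eq: "2 * a e + (int p - b e) = (2 * a e - b e) + int p" by simp
      have "int p dvd 2 * a e + (int p - b e)"
        unfolding eq by (rule dvd_add[OF bmod dvd_refl])
      then show "int p dvd int 2 * a e - int (n e) \<or> int p dvd int 2 * a e + int (n e)"
        using nb[OF \<open>e \<in> F\<close>] bmod[of e] by auto
    next
      show "odd (n e1)"
      proof -
        have "nat (b e1) \<le> p" "even (nat (b e1)) \<longleftrightarrow> even (b e1)"
          using b[OF e(1)] by (simp_all add: nat_le_iff even_nat_iff)
        then show ?thesis using odd_p by (simp add: n_def)
      qed
    qed simp
    moreover have "int (n e2) = b e2" using b[OF e(2)] e(3) by (simp add: n_def)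
    ultimately show ?thesis by simp
  qed
  have "?D dvd int p"
  proof -
    from bmod[of e2] obtain q where q: "2 * a e2 - b e2 = int p * q" by blast
    have pp: "0 < int p" using p_ge_3 by simp
    \<comment> \<open>The bounds \<open>0 < a e2 < p\<close> and \<open>0 < b e2 < p\<close> put
      \<open>2 * a e2 - b e2\<close> strictly between \<open>- p\<close> and \<open>2 * p\<close>.
      So \<open>q\<close> is 0 or 1, and the combination \<open>p - 2 * p * q\<close> below is
      \<open>p\<close> or \<open>- p\<close>.\<close>
    have "int p * (- 1) < int p * q" "int p * q < int p * 2"
      using q a_bounds[OF e(2)] b[OF e(2)] by linarith+
    then have "- 1 < q" "q < 2" unfolding mult_less_cancel_left_pos[OF pp] by simp_all
    then have "q = 0 \<or> q = 1" by auto
    moreover have "?D dvd 2 * (int p - 2 * a e2) - (int p - 2 * b e2)"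
      by (rule dvd_diff[OF dvd_mult[OF D1] D2])
    moreover have "2 * (int p - 2 * a e2) - (int p - 2 * b e2) = int p - 2 * (int p * q)"
      using q by simp
    ultimately show ?thesis by auto
  qed
  then have "pm_gcd G A dvd p" by simp
  have nt: "\<not> A \<subseteq> {\<one>}" using one A(1) by blast
  \<comment> \<open>A common divisor of \<open>p\<close> and \<open>p - 2\<close> divides 2, and the
    gcd is odd.\<close>
  have "pm_gcd G A dvd p - (p - 2)"
    by (rule dvd_diff_nat[OF \<open>pm_gcd G A dvd p\<close> pm_gcd_dvd_prime[OF A(2) nt]])
  then have "pm_gcd G A dvd 2" using p_ge_3 by simp
  then have "pm_gcd G A \<le> 2" by (rule dvd_imp_le) simp
  with odd_pm_gcd[OF A(2) nt] show ?thesis by presburger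
qed

end


section \<open>The dichotomy for subsets of an elementary group\<close>

context odd_elementary_group
begin

text \<open>Coefficient vectors with entries from 0 to \<open>p - 1\<close> give distinct products,
  since the difference of two vectors with equal products is a relation.\<close>

lemma card_independent_le:
  assumes E: "independent (\<lambda>x. x) E" and fin: "finite (carrier G)"
  shows "p ^ card E \<le> card (carrier G)"
proof -
  have finE: "finite E" and id: "(\<lambda>x. x) \<in> E \<rightarrow> carrier G"
    using E by (auto simp: independent_def)
  let ?f = "\<lambda>c. \<Otimes>x\<in>E. x [^] (c x :: int)"
  have "inj_on ?f (E \<rightarrow>\<^sub>E {0..<int p})"
  proof (intro inj_onI)
    fix c d assume c: "c \<in> E \<rightarrow>\<^sub>E {0..<int p}" and d: "d \<in> E \<rightarrow>\<^sub>E {0..<int p}" and eq: "?f c = ?f d"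
    have cl: "?f d \<in> carrier G" using id by (intro finprod_closed) auto
    have cl': "?f (\<lambda>x. c x - d x) \<in> carrier G" using id by (intro finprod_closed) auto
    have "?f (\<lambda>x. (c x - d x) + d x) = ?f (\<lambda>x. c x - d x) \<otimes> ?f d"
      by (rule finprod_int_pow_add[OF id])
    then have "?f (\<lambda>x. c x - d x) \<otimes> ?f d = ?f d" using eq by simp
    then have "?f (\<lambda>x. c x - d x) = \<one>" using cl cl' by simp
    note dvd = independentD[OF E this]
    show "c = d"
    proof (rule PiE_ext[OF c d])
      fix x assume x: "x \<in> E"
      have "c x \<in> {0..<int p}" "d x \<in> {0..<int p}" using c d x by auto
      then show "c x = d x" using dvd[OF x] dvd_imp_le_int[of "c x - d x" "int p"] by force
    qed
  qed
  moreover have "?f ` (E \<rightarrow>\<^sub>E {0..<int p}) \<subseteq> carrier G"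
    using id by (auto intro!: finprod_closed)
  ultimately have "card (E \<rightarrow>\<^sub>E {0..<int p}) \<le> card (carrier G)"
    using fin by (intro card_inj_on_le)
  then show ?thesis using finE by (simp add: card_PiE)
qed

text \<open>In a nontrivial relation on \<open>insert g E\<close> the coefficient of
  \<open>g\<close> is prime to \<open>p\<close>; otherwise the relation would live on the
  independent set \<open>E\<close>. Raising to its inverse \<open>u\<close> modulo \<open>p\<close>
  solves for \<open>g\<close>, and the exponents are then reduced modulo \<open>p\<close>.\<close>

lemma dependent_insert_expression:
  assumes E: "independent (\<lambda>x. x) E" and g: "g \<in> carrier G" "g \<notin> E"
    and dep: "\<not> independent (\<lambda>x. x) (insert g E)"
  obtains a where "\<And>x. x \<in> E \<Longrightarrow> 0 \<le> a x \<and> a x < int p" "g = (\<Otimes>x\<in>E. x [^] a x)"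
proof -
  have finE: "finite E" and id: "(\<lambda>x. x) \<in> E \<rightarrow> carrier G"
    using E by (auto simp: independent_def)
  obtain c :: "'a \<Rightarrow> int" and y where c: "(\<Otimes>x\<in>insert g E. x [^] c x) = \<one>"
    and y: "y \<in> insert g E" "\<not> int p dvd c y"
    using dep finE id g unfolding independent_def by auto
  have cl: "(\<Otimes>x\<in>E. x [^] t x) \<in> carrier G" for t :: "'a \<Rightarrow> int"
    using id by (intro finprod_closed) auto
  have gc: "g [^] c g \<otimes> (\<Otimes>x\<in>E. x [^] c x) = \<one>"
    using c finE id g by (subst (asm) finprod_insert) auto
  have "\<not> int p dvd c g"
  proof
    assume *: "int p dvd c g"
    have "g [^] c g = \<one>" using int_pow_eq_one_iff[OF g(1)] * by (cases "g = \<one>") auto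
    then have "(\<Otimes>x\<in>E. x [^] c x) = \<one>" using gc cl by simp
    then show False using independentD[OF E] y * by blast
  qed
  then have "coprime (c g) (int p)"
    using prime_p by (metis coprime_commute prime_imp_coprime prime_nat_int_transfer)
  then obtain u v where "u * c g + v * int p = 1" using bezout_int[of "c g" "int p"] by auto
  then have "c g * u - 1 = int p * (- v)" by (simp add: algebra_simps)
  then have u: "int p dvd c g * u - 1" by simp
  have "g [^] (c g * u - 1) = \<one>" using int_pow_eq_one_iff[OF g(1)] u by (cases "g = \<one>") auto
  then have "g = g [^] (c g * u)" using g(1) by (simp add: int_pow_diff int_pow_1 inv_solve_right')
  also have "\<dots> = (g [^] c g) [^] u" using g(1) by (simp add: int_pow_pow)
  also have "g [^] c g = inv (\<Otimes>x\<in>E. x [^] c x)"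
    using gc cl g(1) by (metis int_pow_closed inv_equality inv_inv inv_closed m_comm)
  also have "\<dots> = (\<Otimes>x\<in>E. x [^] c x) [^] (- 1 :: int)" using cl by (simp add: int_pow_neg)
  also have "\<dots> [^] u = (\<Otimes>x\<in>E. x [^] c x) [^] (- u)" using cl by (simp add: int_pow_pow)
  also have "\<dots> = (\<Otimes>x\<in>E. x [^] (c x * - u))" by (rule finprod_int_pow_pow[OF finE id])
  also have "\<dots> = (\<Otimes>x\<in>E. x [^] ((c x * - u) mod int p))"
  proof (intro finprod_cong')
    fix x assume x: "x \<in> E"
    then have xc: "x \<in> carrier G" "x \<noteq> \<one>" using id independent_not_one[OF E x] by auto
    have "x [^] (c x * - u - (c x * - u) mod int p) = \<one>"
      using int_pow_eq_one_iff[OF xc] by (simp add: minus_mod_eq_mult_div del: mult_minus_right)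
    then show "x [^] (c x * - u) = x [^] ((c x * - u) mod int p)"
      using xc by (simp add: int_pow_diff inv_solve_right' del: mult_minus_right)
  qed (use id in auto)
  finally show thesis
    using p_ge_3 by (intro that[of "\<lambda>x. (c x * - u) mod int p"]) simp_all
qed

lemma exists_maximal_independent:
  assumes "finite A" "A \<subseteq> carrier G"
  obtains E where "E \<subseteq> A" "independent (\<lambda>x. x) E"
    "\<And>g. g \<in> A - E \<Longrightarrow> \<not> independent (\<lambda>x. x) (insert g E)"
proof -
  let ?F = "{E. E \<subseteq> A \<and> independent (\<lambda>x. x) E}"
  have "finite ?F" "?F \<noteq> {}" using assms(1) by (auto simp: independent_def)
  then have "\<exists>E\<in>?F. \<forall>D\<in>?F. E \<subseteq> D \<longrightarrow> E = D" by (rule finite_has_maximal)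
  then obtain E where E: "E \<in> ?F" and max: "\<forall>D\<in>?F. E \<subseteq> D \<longrightarrow> E = D" by (rule bexE)
  show thesis
  proof (rule that[of E])
    fix g assume "g \<in> A - E"
    with E have "insert g E \<in> ?F" if "independent (\<lambda>x. x) (insert g E)" using that by simp
    with bspec[OF max, of "insert g E"] \<open>g \<in> A - E\<close>
    show "\<not> independent (\<lambda>x. x) (insert g E)" by blast
  qed (use E in auto)
qed

lemma pm_gcd_eq_one_or_lines:
  assumes A: "A \<subseteq> carrier G - {\<one>}" "A \<noteq> {}" and fin: "finite (carrier G)"
  obtains "pm_gcd G A = 1"
  | E B where "E \<noteq> {}" "independent (\<lambda>x. x) E"
    "\<And>e. e \<in> E \<Longrightarrow> B e \<subseteq> carrier (integer_mod_group p) - {0} \<and> B e \<noteq> {}"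
    "A = (\<Union>e\<in>E. (\<lambda>k. e [^] k) ` B e)"
proof -
  have "finite A" "A \<subseteq> carrier G" using A fin finite_subset by auto
  then obtain E where E: "E \<subseteq> A" "independent (\<lambda>x. x) E"
    and max: "\<And>g. g \<in> A - E \<Longrightarrow> \<not> independent (\<lambda>x. x) (insert g E)"
    using exists_maximal_independent by blast
  have Z: "carrier (integer_mod_group p) - {0} = {0<..<int p}"
    using p_ge_3 by (auto simp: carrier_integer_mod_group)
  show thesis
  proof (cases "pm_gcd G A = 1")
    case False
    have line: "\<exists>e\<in>E. \<exists>k\<in>{0<..<int p}. g = e [^] k" if g: "g \<in> A" for g
    proof (cases "g \<in> E")
      case True
      then show ?thesis using p_ge_3 g A by (intro bexI[of _ g] bexI[of _ 1]) auto
    next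
      case gE: False
      have gc: "g \<in> carrier G" "g \<noteq> \<one>" using A g by auto
      obtain a where a: "\<And>x. x \<in> E \<Longrightarrow> 0 \<le> a x \<and> a x < int p" "g = (\<Otimes>x\<in>E. x [^] a x)"
        using dependent_insert_expression[OF E(2) gc(1) gE] max g gE by blast
      \<comment> \<open>Restricting to the support of \<open>g\<close> makes all coefficients
        nonzero modulo \<open>p\<close>, as a circuit demands.\<close>
      define F where "F = {x \<in> E. a x \<noteq> 0}"
      have FE: "F \<subseteq> E" and FA: "F \<subseteq> A" using E(1) by (auto simp: F_def)
      have finE: "finite E" and Ec: "E \<subseteq> carrier G" using E(2) by (auto simp: independent_def)
      have gF: "g = (\<Otimes>x\<in>F. x [^] a x)"
        unfolding a(2) using finE FE Ec
        by (intro finprod_mono_neutral_cong_right) (auto simp: F_def)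
      have aF: "0 < a x \<and> a x < int p" if "x \<in> F" for x using a(1)[of x] that by (auto simp: F_def)
      have "F \<noteq> {}" using gF gc(2) by auto
      then obtain e1 where e1: "e1 \<in> F" by blast
      \<comment> \<open>Two elements in the support would put a circuit with two nonzero
        coefficients inside \<open>A\<close> and force the gcd to be 1.\<close>
      have "F = {e1}"
      proof (rule ccontr)
        assume "F \<noteq> {e1}"
        then obtain e2 where e2: "e2 \<in> F" "e1 \<noteq> e2" using e1 by blast
        interpret odd_elementary_circuit G p F g a
          using independent_subset[OF E(2) FE] gE FE aF gF by unfold_locales auto
        have "insert g F \<subseteq> A" "A \<subseteq> carrier G" using g FA A by auto
        from pm_gcd_circuit[OF this e1 e2] False show False by blast
      qed
      then have "g = e1 [^] a e1" using gF e1 FE Ec by auto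
      with aF[OF e1] e1 FE show ?thesis by (intro bexI[of _ e1] bexI[of _ "a e1"]) auto
    qed
    \<comment> \<open>All exponents that lead into \<open>A\<close> are taken, so the union of the
      lines' parts is exactly \<open>A\<close>. The exponent 1 is among them because
      \<open>E\<close> lies in \<open>A\<close>.\<close>
    define B where "B e = {k \<in> {0<..<int p}. e [^] k \<in> A}" for e
    show thesis
    proof (rule that(2)[of E B])
      show "E \<noteq> {}" using A(2) line by blast
      show "A = (\<Union>e\<in>E. (\<lambda>k. e [^] k) ` B e)"
      proof (intro equalityI subsetI)
        fix g assume "g \<in> A"
        with line[OF this] show "g \<in> (\<Union>e\<in>E. (\<lambda>k. e [^] k) ` B e)"
          unfolding B_def by blast
      qed (auto simp: B_def)
      fix e assume "e \<in> E"
      then have "e \<in> A" "e \<in> carrier G" using E(1) A by auto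
      then have "1 \<in> B e" using p_ge_3 by (simp add: B_def)
      moreover have "B e \<subseteq> {0<..<int p}" by (auto simp: B_def)
      ultimately show "B e \<subseteq> carrier (integer_mod_group p) - {0} \<and> B e \<noteq> {}"
        unfolding Z by blast
    qed (rule E(2))
  qed (rule that(1))
qed

end

section \<open>The cyclic group of order p and its powers\<close>

lemma odd_elementary_group_integer_mod_group:
  assumes "Factorial_Ring.prime p" "odd p"
  shows "odd_elementary_group (integer_mod_group p) p"
proof -
  interpret comm_group "integer_mod_group p" by simp
  show ?thesis
    by unfold_locales (use assms in auto)
qed

lemma comm_group_elementary_group: "comm_group (elementary_group p r)"
proof -
  have "group (elementary_group p r)" unfolding elementary_group_def by (intro sum_group) simp
  then show ?thesis
    by (rule group.group_comm_groupI) (auto simp: elementary_group_def add.commute)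
qed

lemma carrier_elementary_group:
  "carrier (elementary_group p r) = (\<Pi>\<^sub>E i\<in>{1..r}. carrier (integer_mod_group p))"
  by (simp add: elementary_group_def carrier_sum_group)

lemma group_hom_elementary_group_coordinate:
  assumes "i \<in> {1..r}"
  shows "group_hom (elementary_group p r) (integer_mod_group p) (\<lambda>x. x i)"
proof (intro group_hom.intro group_hom_axioms.intro homI)
  show "Group.group (elementary_group p r)"
    using comm_group_elementary_group comm_group.axioms(2) by blast
  show "x i \<in> carrier (integer_mod_group p)" if "x \<in> carrier (elementary_group p r)" for x
    using that assms by (auto simp: carrier_elementary_group)
qed (use assms in \<open>auto simp: elementary_group_def\<close>)

lemma odd_elementary_group_elementary_group:
  assumes "Factorial_Ring.prime p" "odd p"
  shows "odd_elementary_group (elementary_group p r) p"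
proof -
  interpret V: comm_group "elementary_group p r" by (rule comm_group_elementary_group)
  interpret Z: odd_elementary_group "integer_mod_group p" p
    by (rule odd_elementary_group_integer_mod_group[OF assms])
  have "x [^]\<^bsub>elementary_group p r\<^esub> p = \<one>\<^bsub>elementary_group p r\<^esub>"
    if x: "x \<in> carrier (elementary_group p r)" for x
  proof (rule PiE_ext)
    show "x [^]\<^bsub>elementary_group p r\<^esub> p \<in> (\<Pi>\<^sub>E i\<in>{1..r}. carrier (integer_mod_group p))"
      "\<one>\<^bsub>elementary_group p r\<^esub> \<in> (\<Pi>\<^sub>E i\<in>{1..r}. carrier (integer_mod_group p))"
      using V.nat_pow_closed[OF x] V.one_closed by (simp_all add: carrier_elementary_group)
    fix i assume i: "i \<in> {1..r}"
    interpret h: group_hom "elementary_group p r" "integer_mod_group p" "\<lambda>x. x i"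
      by (rule group_hom_elementary_group_coordinate[OF i])
    show "(x [^]\<^bsub>elementary_group p r\<^esub> p) i = \<one>\<^bsub>elementary_group p r\<^esub> i"
      using h.hom_nat_pow[OF x, of p] h.hom_one Z.exponent[OF h.hom_closed[OF x]] by simp
  qed
  then show ?thesis by unfold_locales (use assms in auto)
qed

text \<open>Coordinate \<open>j\<close> is a homomorphism and sends the combination with
  coefficients \<open>c\<close> to \<open>c j mod int p\<close>.\<close>

lemma independent_unit_vectors:
  assumes "Factorial_Ring.prime p" "odd p"
  shows "odd_elementary_group.independent (elementary_group p r) p
    (\<lambda>i. \<lambda>j\<in>{1..r}. if j = i then 1 else 0) {1..r}"
proof -
  interpret V: odd_elementary_group "elementary_group p r" p
    by (rule odd_elementary_group_elementary_group[OF assms])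
  interpret Z: odd_elementary_group "integer_mod_group p" p
    by (rule odd_elementary_group_integer_mod_group[OF assms])
  let ?e = "\<lambda>i. \<lambda>j\<in>{1..r}. if j = i then 1 else 0 :: int"
  have e: "?e \<in> {1..r} \<rightarrow> carrier (elementary_group p r)"
    using Z.p_ge_3 by (auto simp: carrier_elementary_group)
  show ?thesis
    unfolding V.independent_def
  proof (intro conjI allI impI ballI)
    fix c :: "nat \<Rightarrow> int" and j
    let ?P = "finprod (elementary_group p r) (\<lambda>i. ?e i [^]\<^bsub>elementary_group p r\<^esub> c i) {1..r}"
    assume P: "?P = \<one>\<^bsub>elementary_group p r\<^esub>" and j: "j \<in> {1..r}"
    interpret h: group_hom "elementary_group p r" "integer_mod_group p" "\<lambda>x. x j"
      by (rule group_hom_elementary_group_coordinate[OF j])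
    have "?P j = finprod (integer_mod_group p) (\<lambda>i. (?e i [^]\<^bsub>elementary_group p r\<^esub> c i) j) {1..r}"
      using e by (intro Z.hom_finprod[OF h.group_hom_axioms V.comm_group_axioms]) auto
    also have "\<dots> = finprod (integer_mod_group p) (\<lambda>i. if i = j then c i mod int p else \<one>\<^bsub>integer_mod_group p\<^esub>) {1..r}"
    proof (intro Z.finprod_cong')
      fix i assume "i \<in> {1..r}"
      then have "(?e i [^]\<^bsub>elementary_group p r\<^esub> c i) j = ?e i j [^]\<^bsub>integer_mod_group p\<^esub> c i"
        using e by (intro h.hom_int_pow) auto
      then show "(?e i [^]\<^bsub>elementary_group p r\<^esub> c i) j =
          (if i = j then c i mod int p else \<one>\<^bsub>integer_mod_group p\<^esub>)"
        using j by (simp add: int_pow_integer_mod_group)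
    qed (use Z.p_ge_3 in \<open>auto simp: carrier_integer_mod_group\<close>)
    also have "\<dots> = c j mod int p"
      using j Z.p_ge_3 by (intro Z.finprod_singleton_swap) (auto simp: carrier_integer_mod_group)
    finally have "c j mod int p = 0" using P h.hom_one by simp
    then show "int p dvd c j" by (simp add: dvd_eq_mod_eq_0)
  qed (use e in auto)
qed

text \<open>The sequence of 1, 1 and \<open>p - 2\<close> has sum \<open>p\<close>, so it is
  zero-sum with all signs positive, and it is an atom because it has three nontrivial terms. Its
  contribution to the gcd is \<open>3 - 2 = 1\<close>.\<close>

lemma one_in_delta_star_integer_mod_group:
  assumes "Factorial_Ring.prime p" "odd p"
  shows "1 \<in> delta_star (pm_monoid (integer_mod_group p) (carrier (integer_mod_group p)))"
proof -
  interpret Z: odd_elementary_group "integer_mod_group p" p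
    by (rule odd_elementary_group_integer_mod_group[OF assms])
  let ?A = "carrier (integer_mod_group p) - {0}"
  have A: "?A = {0<..<int p}" using Z.p_ge_3 by (auto simp: carrier_integer_mod_group)
  let ?gs = "[1, 1, int p - 2]"
  have "{..<length ?gs} = {0, 1, 2}" by auto
  then have "finprod (integer_mod_group p) (\<lambda>i. ?gs ! i [^]\<^bsub>integer_mod_group p\<^esub> (1 :: int)) {..<length ?gs} = 0"
    using Z.p_ge_3 by (simp add: int_pow_integer_mod_group carrier_integer_mod_group Pi_iff mod_simps)
  then have "pm_zero_sum (integer_mod_group p) {#1, 1, int p - 2#}"
    unfolding pm_zero_sum_def by (intro exI[of _ ?gs] exI[of _ "\<lambda>_. 1"]) simp
  then have "pm_atom (integer_mod_group p) {#1, 1, int p - 2#}"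
    using Z.p_ge_3 by (intro Z.pm_atom_size_le_3) (auto simp: A)
  moreover have "set_mset {#1, 1, int p - 2#} \<subseteq> ?A" unfolding A using Z.p_ge_3 by auto
  ultimately have "int (pm_gcd (integer_mod_group p) ?A) dvd
      int (size {#1, 1, int p - 2#} + count {#1, 1, int p - 2#} \<one>\<^bsub>integer_mod_group p\<^esub>) - 2"
    by (intro Z.pm_gcd_dvd) auto
  moreover have "count {#1, 1, int p - 2#} \<one>\<^bsub>integer_mod_group p\<^esub> = 0"
    using Z.p_ge_3 by simp
  ultimately have "int (pm_gcd (integer_mod_group p) ?A) dvd 1" by simp
  then have "pm_gcd (integer_mod_group p) ?A = 1" by simp
  moreover have "?A \<noteq> {}" 
  proof -
    have "1 \<in> {0<..<int p}" using Z.p_ge_3 by simp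
    then show ?thesis unfolding A by blast
  qed
  ultimately show ?thesis
    unfolding Z.delta_star_pm_monoid by (intro image_eqI[of _ _ ?A]) simp_all
qed

theorem theorem4p14:
  fixes p r :: nat
  assumes "Factorial_Ring.prime p" and "odd p" and "r \<ge> 1"
  shows "delta_star (pm_monoid (elementary_group p r) (carrier (elementary_group p r))) =
    {(GCD i\<in>{1..r}. d i) |d :: nat \<Rightarrow> nat.
       \<forall>i\<in>{1..r}. d i \<in> delta_star (pm_monoid (integer_mod_group p) (carrier (integer_mod_group p)))}"
    (is "delta_star (pm_monoid ?V _) = ?R")
proof (intro equalityI subsetI)
  let ?Z = "integer_mod_group p"
  interpret V: odd_elementary_group ?V p
    by (rule odd_elementary_group_elementary_group[OF assms(1,2)])
  interpret Z: odd_elementary_group ?Z p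
    by (rule odd_elementary_group_integer_mod_group[OF assms(1,2)])
  have Z: "pm_gcd ?Z B \<in> delta_star (pm_monoid ?Z (carrier ?Z))"
    if "B \<subseteq> carrier ?Z - {0}" "B \<noteq> {}" for B
    unfolding Z.delta_star_pm_monoid using that by simp
  {
    fix x assume "x \<in> delta_star (pm_monoid ?V (carrier ?V))"
    then obtain A where A: "A \<subseteq> carrier ?V - {\<one>\<^bsub>?V\<^esub>}" "A \<noteq> {}" and x: "x = pm_gcd ?V A"
      unfolding V.delta_star_pm_monoid by blast
    have cZ: "finite (carrier ?Z)" "card (carrier ?Z) = p"
      using Z.p_ge_3 by (auto simp: carrier_integer_mod_group)
    have fin: "finite (carrier ?V)"
      unfolding carrier_elementary_group using cZ by (intro finite_PiE) auto
    show "x \<in> ?R"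
    proof (rule V.pm_gcd_eq_one_or_lines[OF A fin])
      assume "pm_gcd ?V A = 1"
      \<comment> \<open>The family is constantly 1. Its index set is nonempty because
        \<open>r \<ge> 1\<close>; an empty gcd would be 0.\<close>
      then have "x = (GCD i\<in>{1..r}. (\<lambda>_. 1) i)" using x assms(3) by (simp add: image_constant_conv)
      then show ?thesis
        using one_in_delta_star_integer_mod_group[OF assms(1,2)] by blast
    next
      fix E B
      assume E: "E \<noteq> {}" "V.independent (\<lambda>x. x) E"
        and B: "\<And>e. e \<in> E \<Longrightarrow> B e \<subseteq> carrier ?Z - {0} \<and> B e \<noteq> {}"
        and AB: "A = (\<Union>e\<in>E. (\<lambda>k. e [^]\<^bsub>?V\<^esub> k) ` B e)"
      have "p ^ card E \<le> p ^ r"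
        using V.card_independent_le[OF E(2) fin] cZ by (simp add: carrier_elementary_group card_PiE)
      then have "card E \<le> card {1..r}" using Z.p_ge_3 by (simp add: power_increasing_iff)
      moreover have "finite E" using E(2) by (simp add: V.independent_def)
      ultimately have "\<exists>f. inj_on f E \<and> f ` E \<subseteq> {1..r}" by (metis inj_on_iff_card_le finite_atLeastAtMost)
      \<comment> \<open>\<open>E\<close> may have fewer than \<open>r\<close> elements, so
        \<open>f\<close> is only a surjection of the indices onto it; repeated values do not change
        the gcd.\<close>
      then obtain f where f: "f ` {1..r} = E" using inj_on_iff_surj[OF E(1)] by metis
      have "x = (GCD e\<in>E. pm_gcd ?Z (B e))"
        unfolding x AB using B by (intro V.pm_gcd_independent_family[OF E(2)]) auto
      also have "\<dots> = (GCD i\<in>{1..r}. pm_gcd ?Z (B (f i)))"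
        unfolding f[symmetric] image_image ..
      finally have "x = (GCD i\<in>{1..r}. pm_gcd ?Z (B (f i)))" .
      moreover have "\<forall>i\<in>{1..r}. pm_gcd ?Z (B (f i)) \<in> delta_star (pm_monoid ?Z (carrier ?Z))"
      proof
        fix i assume "i \<in> {1..r}"
        then have "f i \<in> E" using f by blast
        with B[OF this] show "pm_gcd ?Z (B (f i)) \<in> delta_star (pm_monoid ?Z (carrier ?Z))"
          by (intro Z) simp_all
      qed
      ultimately show ?thesis by blast
    qed
  next
    fix x assume "x \<in> ?R"
    then obtain d where x: "x = (GCD i\<in>{1..r}. d i)"
      and d: "\<forall>i\<in>{1..r}. d i \<in> delta_star (pm_monoid ?Z (carrier ?Z))" by blast
    from d have "\<forall>i\<in>{1..r}. \<exists>A. A \<subseteq> carrier ?Z - {0} \<and> A \<noteq> {} \<and> d i = pm_gcd ?Z A"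
      unfolding Z.delta_star_pm_monoid by auto
    from bchoice[OF this] obtain A
      where A: "\<And>i. i \<in> {1..r} \<Longrightarrow> A i \<subseteq> carrier ?Z - {0} \<and> A i \<noteq> {} \<and> d i = pm_gcd ?Z (A i)"
      by blast
    let ?e = "\<lambda>i. \<lambda>j\<in>{1..r}. if j = i then 1 else 0 :: int"
    note e = independent_unit_vectors[OF assms(1,2), of r]
    \<comment> \<open>The sets \<open>A i\<close> are placed on the \<open>r\<close> coordinate
      axes, which are independent lines.\<close>
    let ?A = "\<Union>i\<in>{1..r}. (\<lambda>k. ?e i [^]\<^bsub>?V\<^esub> k) ` A i"
    have "pm_gcd ?V ?A = (GCD i\<in>{1..r}. pm_gcd ?Z (A i))"
      using A by (intro V.pm_gcd_independent_family[OF e]) auto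
    also have "\<dots> = x" unfolding x using A by (intro arg_cong[of _ _ Gcd] image_cong) auto
    finally have "x = pm_gcd ?V ?A" by simp
    moreover have "?A \<subseteq> carrier ?V - {\<one>\<^bsub>?V\<^esub>}"
    proof clarify
      fix i k assume i: "i \<in> {1..r}" and k: "k \<in> A i"
      have ei: "?e i \<in> carrier ?V" "?e i \<noteq> \<one>\<^bsub>?V\<^esub>"
        using e V.independent_not_one[OF e i] i by (auto simp: V.independent_def)
      have "0 < k" "k < int p" using A[OF i] k Z.p_ge_3
        by (auto simp: carrier_integer_mod_group subset_iff split: if_splits)
      then have "\<not> int p dvd k" using zdvd_imp_le by force
      then show "?e i [^]\<^bsub>?V\<^esub> k \<in> carrier ?V - {\<one>\<^bsub>?V\<^esub>}"
        using V.int_pow_eq_one_iff[OF ei] ei by simp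
    qed
    moreover have "?A \<noteq> {}" using A[of 1] assms(3) by auto
    ultimately show "x \<in> delta_star (pm_monoid ?V (carrier ?V))"
      unfolding V.delta_star_pm_monoid by blast
  }
qed

end
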